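(* There is a universal constant $C>0$ such that for every weighted finite graph $G$ with $N$ vertices and all $1\leq k\leq l\leq N$, \[ 1-\overline{h}(k)\leq Clk^6\,\frac{2-\lambda_{N-k+1}}{\sqrt{2-\lambda_{N-l+1}}}. \]
   Context: $G=(V,E,w)$ is a finite undirected graph without self-loops, $N=|V|$, positive symmetric edge weights $w_{uv}$ ($w_{uv}=0$ for non-edges), degrees $d_u=\sum_vw_{uv}$ (implicitly positive). $|E(A,B)|:=\sum_{u\in A,v\in B}w_{uv}$, $\mathrm{vol}(A)=\sum_{u\in A}d_u$. The normalized Laplacian $\Delta f(u)=\frac{1}{d_u}\sum_vw_{uv}(f(u)-f(v))$ has eigenvalues (with multiplicity) $0=\lambda_1\leq\cdots\leq\lambda_N\leq2$. For disjoint $V_1,V_2$ with $V_1\cup V_2\neq\emptyset$, $\overline{\phi}(V_1,V_2)=2|E(V_1,V_2)|/\mathrm{vol}(V_1\cup V_2)$; $\overline{h}(k):=\max\min_{1\leq i\leq k}\overline{\phi}(V_{2i-1},V_{2i})$ over all collections of $k$ pairs $(V_1,V_2),\ldots,(V_{2k-1},V_{2k})$ of pairwise disjoint subsets of $V$ with $V_{2i-1}\cup V_{2i}\neq\emptyset$ for each $i$. *)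

theory Defs
  imports Complex_Main "Jordan_Normal_Form.Char_Poly"
begin

definition wgraph :: "nat \<Rightarrow> (nat \<Rightarrow> nat \<Rightarrow> real) \<Rightarrow> bool" where
  "wgraph N w \<longleftrightarrow>
     (\<forall>u<N. \<forall>v<N. w u v \<ge> 0 \<and> w u v = w v u) \<and>
     (\<forall>u<N. w u u = 0) \<and>
     (\<forall>u<N. (\<Sum>v<N. w u v) > 0)"

definition deg :: "nat \<Rightarrow> (nat \<Rightarrow> nat \<Rightarrow> real) \<Rightarrow> nat \<Rightarrow> real" where
  "deg N w u = (\<Sum>v<N. w u v)"

definition vol :: "nat \<Rightarrow> (nat \<Rightarrow> nat \<Rightarrow> real) \<Rightarrow> nat set \<Rightarrow> real" where
  "vol N w A = (\<Sum>u\<in>A. deg N w u)"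

definition edges_between :: "(nat \<Rightarrow> nat \<Rightarrow> real) \<Rightarrow> nat set \<Rightarrow> nat set \<Rightarrow> real" where
  "edges_between w A B = (\<Sum>u\<in>A. \<Sum>v\<in>B. w u v)"

definition phibar :: "nat \<Rightarrow> (nat \<Rightarrow> nat \<Rightarrow> real) \<Rightarrow> nat set \<Rightarrow> nat set \<Rightarrow> real" where
  "phibar N w A B = 2 * edges_between w A B / vol N w (A \<union> B)"

definition admissible_pairs :: "nat \<Rightarrow> nat \<Rightarrow> (nat \<Rightarrow> nat set) \<Rightarrow> (nat \<Rightarrow> nat set) \<Rightarrow> bool" where
  "admissible_pairs N k A B \<longleftrightarrow>
     (\<forall>i<k. A i \<subseteq> {..<N} \<and> B i \<subseteq> {..<N} \<and> A i \<union> B i \<noteq> {}) \<and>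
     (\<forall>i<k. \<forall>j<k. A i \<inter> B j = {}) \<and>
     (\<forall>i<k. \<forall>j<k. i \<noteq> j \<longrightarrow> A i \<inter> A j = {} \<and> B i \<inter> B j = {})"

definition hbar :: "nat \<Rightarrow> (nat \<Rightarrow> nat \<Rightarrow> real) \<Rightarrow> nat \<Rightarrow> real" where
  "hbar N w k = Max {Min {phibar N w (A i) (B i) | i. i < k} | A B. admissible_pairs N k A B}"

definition norm_laplacian :: "nat \<Rightarrow> (nat \<Rightarrow> nat \<Rightarrow> real) \<Rightarrow> real mat" where
  "norm_laplacian N w = mat N N (\<lambda>(u,v). (if u = v then 1 else 0) - w u v / deg N w u)"

text \<open>Eigenvalues with multiplicity in nondecreasing order: the sorted list of roots of the
  characteristic polynomial (which splits over the reals, L being similar to a symmetric matrix).\<close>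
definition laplacian_eigenvalues :: "nat \<Rightarrow> (nat \<Rightarrow> nat \<Rightarrow> real) \<Rightarrow> real list" where
  "laplacian_eigenvalues N w = (THE xs. sorted xs \<and> length xs = N \<and>
       char_poly (norm_laplacian N w) = (\<Prod>x\<leftarrow>xs. [:- x, 1:]))"

text \<open>lambda_i for 1 \<le> i \<le> N (1-based indexing as in the paper).\<close>
definition lambda :: "nat \<Rightarrow> (nat \<Rightarrow> nat \<Rightarrow> real) \<Rightarrow> nat \<Rightarrow> real" where
  "lambda N w i = laplacian_eigenvalues N w ! (i - 1)"

end

theory Submission
  imports Defs "HOL-Analysis.Convex" "HOL-Library.Disjoint_Sets"
begin

text \<open>
  Write \<open>\<mu> k = 2 - \<lambda> (N - k + 1)\<close>; it is the \<open>k\<close>-th smallest eigenvalue of the quadratic form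
  \<open>\<Sum> w u v * (f u + f v)\<^sup>2\<close>, halved because the sum counts every edge twice.

  The top \<open>k\<close> eigenfunctions embed the vertices into \<open>\<real>\<^sup>k\<close>. Orthonormality forbids more than about
  unit mass near any single line through the origin, so region growing in the projective distance
  produces \<open>k\<close> well separated sets of vertices of mass at least \<open>1/2\<close>. Cutting the embedding off
  around these sets and keeping the best coordinate gives \<open>k\<close> disjointly supported functions
  whose Rayleigh quotient is \<open>O(k\<^sup>6) * \<mu> k\<close>.

  Each such function \<open>f\<close> is swept after composition with the odd primitive of the distance to a
  set of \<open>2 * l\<close> thresholds. The thresholds are chosen so that every interval between them captures
  the same amount of the norm of \<open>f\<close>; if they did not exhaust the range of \<open>f\<close>, the truncations
  of \<open>f\<close> to these intervals would be too many disjointly supported functions of small energy,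
  contradicting the min-max principle for \<open>\<mu> l\<close>. The sweep therefore loses only a factor
  \<open>O(l / sqrt (\<mu> l))\<close>.
\<close>

unbundle no inner_syntax

section \<open>The spectral theorem for real symmetric matrices\<close>

lemma real_symmetric_eigenvalue_in_Reals:
  fixes A :: "real mat"
  assumes carrier: "A \<in> carrier_mat n n" and symmetric: "A\<^sup>T = A"
    and eigenvalue: "eigenvalue (map_mat complex_of_real A) a"
  shows "a \<in> \<real>"
proof -
  let ?B = "map_mat complex_of_real A"
  have B_carrier: "?B \<in> carrier_mat n n" using carrier by simp
  have B_transpose: "?B\<^sup>T = ?B" using symmetric by (metis map_mat_transpose)
  obtain v where v: "v \<in> carrier_vec n" "v \<noteq> 0\<^sub>v n" "?B *\<^sub>v v = a \<cdot>\<^sub>v v"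
    using eigenvalue carrier unfolding eigenvalue_def eigenvector_def by auto
  have real_entries: "?B *\<^sub>v conjugate v = conjugate (?B *\<^sub>v v)"
    using carrier v(1) by (intro eq_vecI) (auto simp: scalar_prod_def)
  have "a * (v \<bullet>c v) = (?B\<^sup>T *\<^sub>v v) \<bullet>c v" using v B_transpose by simp
  also have "\<dots> = v \<bullet> (?B *\<^sub>v conjugate v)"
    using B_carrier v(1) by (intro transpose_vec_mult_scalar) auto
  also have "\<dots> = cnj a * (v \<bullet>c v)"
    unfolding real_entries v(3) conjugate_smult_vec using v(1) by simp
  finally have "a = cnj a" using conjugate_square_eq_0_vec[OF v(1)] v(2) by simp
  then show ?thesis by (simp add: Reals_cnj_iff)
qed

lemma real_symmetric_char_poly_splits:
  fixes A :: "real mat"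
  assumes carrier: "A \<in> carrier_mat n n" and symmetric: "A\<^sup>T = A"
  obtains es where "length es = n" "char_poly A = (\<Prod>e\<leftarrow>es. [:- e, 1:])"
proof -
  let ?B = "map_mat complex_of_real A"
  have B_carrier: "?B \<in> carrier_mat n n" using carrier by simp
  obtain as where as: "char_poly ?B = (\<Prod>a\<leftarrow>as. [:- a, 1:])" "length as = n"
    using char_poly_factorized[OF B_carrier] by blast
  have "a \<in> \<real>" if "a \<in> set as" for a
  proof (rule real_symmetric_eigenvalue_in_Reals[OF carrier symmetric])
    have "poly (char_poly ?B) a = 0"
      unfolding as poly_prod_list prod_list_zero_iff using that by force
    then show "eigenvalue ?B a" using eigenvalue_root_char_poly[OF B_carrier] by simp
  qed
  then have as_real: "as = map complex_of_real (map Re as)"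
    by (auto simp: map_idI)
  interpret map_poly_inj_comm_ring_hom complex_of_real ..
  have linear: "map_poly complex_of_real [:- e, 1:] = [:- complex_of_real e, 1:]" for e
    by (rule poly_eqI) (auto simp: coeff_map_poly coeff_pCons split: nat.splits)
  have "map_poly complex_of_real (\<Prod>e\<leftarrow>es. [:- e, 1:])
      = (\<Prod>a\<leftarrow>map complex_of_real es. [:- a, 1:])" for es
    by (induction es) (simp_all add: hom_mult linear del: mult_pCons_left)
  then have "map_poly complex_of_real (char_poly A)
      = map_poly complex_of_real (\<Prod>e\<leftarrow>map Re as. [:- e, 1:])"
    using as(1) as_real of_real_hom.char_poly_hom[OF carrier, where ?'a = complex] by metis
  then have "char_poly A = (\<Prod>e\<leftarrow>map Re as. [:- e, 1:])" by (rule injectivity)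
  then show ?thesis using as(2) by (intro that[of "map Re as"]) auto
qed

lemma linear_factors_unique:
  fixes xs ys :: "'a::idom list"
  assumes "(\<Prod>x\<leftarrow>xs. [:- x, 1:]) = (\<Prod>y\<leftarrow>ys. [:- y, 1:])"
  shows "mset xs = mset ys"
proof -
  have "proots (\<Prod>x\<leftarrow>xs. [:- x, 1:]) = mset xs" for xs :: "'a list"
  proof (induction xs)
    case (Cons x xs)
    have "(\<Prod>x\<leftarrow>xs. [:- x, 1:]) \<noteq> 0" by (auto simp: prod_list_zero_iff)
    then show ?case using Cons by (simp add: proots_mult del: mult_pCons_left)
  qed simp
  then show ?thesis using assms by metis
qed

definition householder :: "real vec \<Rightarrow> real mat" where
  "householder z = mat (dim_vec z) (dim_vec z)
     (\<lambda>(i, j). of_bool (i = j) - 2 * z $ i * z $ j / (z \<bullet> z))"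

lemma householder_carrier [simp]: "z \<in> carrier_vec n \<Longrightarrow> householder z \<in> carrier_mat n n"
  by (auto simp: householder_def)

lemma transpose_householder: "(householder z)\<^sup>T = householder z"
  by (intro eq_matI) (auto simp: householder_def)

lemma householder_involution:
  assumes carrier: "z \<in> carrier_vec n" and "z \<noteq> 0\<^sub>v n"
  shows "householder z * householder z = 1\<^sub>m n"
proof (rule eq_matI)
  define q where "q = z \<bullet> z"
  have q_nonzero: "q \<noteq> 0" and sum_squares: "(\<Sum>r<n. (z $ r)\<^sup>2) = q"
    using conjugate_square_eq_0_vec[OF carrier] assms
    by (auto simp: q_def scalar_prod_def power2_eq_square atLeast0LessThan)
  fix i j assume "i < dim_row (1\<^sub>m n :: real mat)" "j < dim_col (1\<^sub>m n :: real mat)"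
  then have in_range: "i < n" "j < n" by auto
  have "(householder z * householder z) $$ (i, j) =
    (\<Sum>r<n. (of_bool (i = r) - 2 * z $ i * z $ r / q) * (of_bool (r = j) - 2 * z $ r * z $ j / q))"
    using in_range carrier
    by (auto simp: householder_def q_def scalar_prod_def atLeast0LessThan)
  also have "\<dots> = (\<Sum>r<n. (if r = i then of_bool (i = j) - 2 * z $ i * z $ j / q else 0)
      - (if r = j then 2 * z $ i * z $ j / q else 0) + 4 * z $ i * z $ j / q\<^sup>2 * (z $ r)\<^sup>2)"
    by (intro sum.cong) (auto simp: algebra_simps power2_eq_square)
  also have "\<dots> = of_bool (i = j) - 4 * z $ i * z $ j / q + 4 * z $ i * z $ j / q\<^sup>2 * q"
    unfolding sum.distrib sum_subtractf sum_distrib_left[symmetric] using in_range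
    by (simp add: sum.delta sum_squares)
  also have "\<dots> = 1\<^sub>m n $$ (i, j)" using in_range q_nonzero by (simp add: power2_eq_square)
  finally show "(householder z * householder z) $$ (i, j) = 1\<^sub>m n $$ (i, j)" .
qed (use carrier in \<open>auto simp: householder_def\<close>)

lemma symmetric_involution_with_first_col:
  fixes v :: "real vec"
  assumes carrier: "v \<in> carrier_vec (Suc m)" and unit: "v \<bullet> v = 1"
  obtains W where "W \<in> carrier_mat (Suc m) (Suc m)" "W\<^sup>T = W" "W * W = 1\<^sub>m (Suc m)" "col W 0 = v"
proof (cases "v = unit_vec (Suc m) 0")
  case True
  then show ?thesis by (intro that[of "1\<^sub>m (Suc m)"]) auto
next
  case False
  let ?e = "unit_vec (Suc m) 0 :: real vec"
  define z where "z = v - ?e"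
  have z_carrier: "z \<in> carrier_vec (Suc m)" using carrier by (simp add: z_def)
  have z_index: "z $ i = v $ i - of_bool (i = 0)" if "i < Suc m" for i
    using that carrier by (auto simp: z_def)
  have "z \<noteq> 0\<^sub>v (Suc m)"
  proof
    assume "z = 0\<^sub>v (Suc m)"
    then have "v $ i = of_bool (i = 0)" if "i < Suc m" for i using z_index[OF that] that by simp
    then have "v = ?e" using carrier by (intro eq_vecI) auto
    then show False using False by simp
  qed
  have "z \<bullet> z = - 2 * z $ 0"
  proof -
    have "z \<bullet> z = v \<bullet> v - v \<bullet> ?e - (?e \<bullet> v - ?e \<bullet> ?e)"
      unfolding z_def using carrier
      by (simp add: minus_scalar_prod_distrib[of _ "Suc m"] scalar_prod_minus_distrib[of _ "Suc m"])
    then show ?thesis using carrier unit z_index[of 0] by simp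
  qed
  moreover have "z \<bullet> z \<noteq> 0"
    using conjugate_square_eq_0_vec[OF z_carrier] \<open>z \<noteq> 0\<^sub>v (Suc m)\<close> by simp
  ultimately have "2 * z $ i * z $ 0 / (z \<bullet> z) = - z $ i" for i by (simp add: field_simps)
  then have "col (householder z) 0 = v"
    using z_carrier carrier by (intro eq_vecI) (auto simp: householder_def z_index)
  then show ?thesis
    using z_carrier householder_involution[OF z_carrier \<open>z \<noteq> 0\<^sub>v (Suc m)\<close>] transpose_householder
    by (intro that[of "householder z"]) auto
qed

definition border_mat :: "'a::zero \<Rightarrow> 'a mat \<Rightarrow> 'a mat" where
  "border_mat x M = four_block_mat (mat 1 1 (\<lambda>_. x)) (0\<^sub>m 1 (dim_col M)) (0\<^sub>m (dim_row M) 1) M"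

lemma border_mat_carrier [simp]:
  "M \<in> carrier_mat m m \<Longrightarrow> border_mat x M \<in> carrier_mat (Suc m) (Suc m)"
  by (auto simp: border_mat_def)

lemma border_mat_mult:
  fixes M :: "'a::comm_semiring_1 mat"
  assumes "M \<in> carrier_mat m m" "M' \<in> carrier_mat m m"
  shows "border_mat x M * border_mat y M' = border_mat (x * y) (M * M')"
proof -
  have "mat 1 1 (\<lambda>_. x) * mat 1 1 (\<lambda>_. y) = mat 1 1 (\<lambda>_. x * y)"
    by (intro eq_matI) (auto simp: scalar_prod_def)
  then show ?thesis using assms
    by (simp add: border_mat_def mult_four_block_mat[of _ 1 1 _ m _ m _ _ 1 _ m])
qed

lemma transpose_border_mat: "M \<in> carrier_mat m m \<Longrightarrow> (border_mat x M)\<^sup>T = border_mat x (M\<^sup>T)"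
  by (intro eq_matI) (auto simp: border_mat_def)

lemma border_mat_one: "border_mat 1 (1\<^sub>m m) = 1\<^sub>m (Suc m)"
  by (intro eq_matI) (auto simp: border_mat_def)

lemma border_mat_diag: "border_mat (d 0) (mat_diag m (\<lambda>i. d (Suc i))) = mat_diag (Suc m) d"
  by (intro eq_matI) (auto simp: border_mat_def mat_diag_def)

lemma char_poly_border_mat:
  fixes M :: "'a::comm_ring_1 mat"
  assumes "M \<in> carrier_mat m m"
  shows "char_poly (border_mat x M) = [:- x, 1:] * char_poly M"
proof -
  have "char_poly (mat 1 1 (\<lambda>_. x)) = [:- x, 1:]" by (simp add: char_poly_defs det_single)
  moreover have "dim_row M = m" "dim_col M = m" using assms by auto
  ultimately show ?thesis
    unfolding border_mat_def using assms
    by (simp add: char_poly_four_block_zeros_col[of _ _ m] del: mult_pCons_left One_nat_def)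
qed

lemma symmetric_mat_eq_border_mat:
  fixes B :: "'a::semiring_1 mat"
  assumes carrier: "B \<in> carrier_mat (Suc m) (Suc m)" and symmetric: "B\<^sup>T = B"
    and first_col: "col B 0 = e \<cdot>\<^sub>v unit_vec (Suc m) 0"
  obtains M where "M \<in> carrier_mat m m" "M\<^sup>T = M" "B = border_mat e M"
proof
  define M where "M = mat m m (\<lambda>(i, j). B $$ (Suc i, Suc j))"
  have B_commute: "B $$ (i, j) = B $$ (j, i)" if "i < Suc m" "j < Suc m" for i j
    using that carrier symmetric by (metis carrier_matD index_transpose_mat(1))
  have B_first_col: "B $$ (i, 0) = (if i = 0 then e else 0)" if "i < Suc m" for i
    using arg_cong[OF first_col, of "\<lambda>x. x $ i"] that carrier by (auto split: if_splits)
  show "M \<in> carrier_mat m m" by (simp add: M_def)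
  show "M\<^sup>T = M" unfolding M_def using B_commute by (intro eq_matI) auto
  show "B = border_mat e M"
    using carrier B_first_col B_commute[of 0] by (intro eq_matI) (auto simp: border_mat_def M_def)
qed

lemma eigenvalue_unit_eigenvector:
  fixes A :: "real mat"
  assumes carrier: "A \<in> carrier_mat n n" and "eigenvalue A e"
  obtains v where "v \<in> carrier_vec n" "v \<bullet> v = 1" "A *\<^sub>v v = e \<cdot>\<^sub>v v"
proof -
  obtain x where x: "x \<in> carrier_vec n" "x \<noteq> 0\<^sub>v n" "A *\<^sub>v x = e \<cdot>\<^sub>v x"
    using assms unfolding eigenvalue_def eigenvector_def by auto
  have "0 < x \<bullet> x" using conjugate_square_greater_0_vec[OF x(1)] x(2) by simp
  then show ?thesis
    using x carrier by (intro that[of "(1 / sqrt (x \<bullet> x)) \<cdot>\<^sub>v x"])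
      (auto simp: mult_mat_vec[OF carrier x(1)] smult_smult_assoc mult_ac)
qed

lemma real_symmetric_deflation:
  fixes A :: "real mat"
  assumes carrier: "A \<in> carrier_mat (Suc m) (Suc m)" and symmetric: "A\<^sup>T = A"
    and "eigenvalue A e"
  obtains W M where "W \<in> carrier_mat (Suc m) (Suc m)" "W\<^sup>T = W" "W * W = 1\<^sub>m (Suc m)"
    "M \<in> carrier_mat m m" "M\<^sup>T = M" "A = W * border_mat e M * W"
proof -
  let ?n = "Suc m"
  note assoc = assoc_mult_mat[of _ ?n ?n _ ?n _ ?n]
  obtain v where v: "v \<in> carrier_vec ?n" "v \<bullet> v = 1" "A *\<^sub>v v = e \<cdot>\<^sub>v v"
    using eigenvalue_unit_eigenvector[OF carrier assms(3)] by blast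
  obtain W where W: "W \<in> carrier_mat ?n ?n" "W\<^sup>T = W" "W * W = 1\<^sub>m ?n" "col W 0 = v"
    using symmetric_involution_with_first_col[OF v(1,2)] by blast
  define B where "B = W * (A * W)"
  have B_carrier: "B \<in> carrier_mat ?n ?n" unfolding B_def using carrier W by auto
  have "B\<^sup>T = B" unfolding B_def using carrier W symmetric
    by (simp add: transpose_mult[of _ ?n ?n _ ?n] assoc)
  moreover have "col B 0 = e \<cdot>\<^sub>v unit_vec ?n 0"
  proof -
    have "A * W \<in> carrier_mat ?n ?n" using carrier W(1) by simp
    then have "col B 0 = W *\<^sub>v (A *\<^sub>v col W 0)"
      unfolding B_def by (simp add: col_mult2[OF W(1)] col_mult2[OF carrier W(1)])
    also have "\<dots> = e \<cdot>\<^sub>v (W *\<^sub>v col W 0)" using v W by (simp add: mult_mat_vec)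
    also have "W *\<^sub>v col W 0 = col (W * W) 0" by (simp add: col_mult2[OF W(1) W(1)])
    finally show ?thesis unfolding W(3) by simp
  qed
  ultimately obtain M where M: "M \<in> carrier_mat m m" "M\<^sup>T = M" "B = border_mat e M"
    using symmetric_mat_eq_border_mat[OF B_carrier] by blast
  have "W * B * W = (W * W) * A * (W * W)" unfolding B_def using carrier W(1) by (simp add: assoc)
  then have "A = W * B * W" using carrier W(3) by simp
  then show ?thesis using that W M by blast
qed

definition orthogonal_diagonalization :: "nat \<Rightarrow> real mat \<Rightarrow> (nat \<Rightarrow> real) \<Rightarrow> real mat \<Rightarrow> bool" where
  "orthogonal_diagonalization n U d A \<longleftrightarrow>
     U \<in> carrier_mat n n \<and> U\<^sup>T * U = 1\<^sub>m n \<and> A = U * mat_diag n d * U\<^sup>T"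

lemma orthogonal_diagonalization_border_mat:
  assumes "orthogonal_diagonalization m U (\<lambda>i. d (Suc i)) M"
  shows "orthogonal_diagonalization (Suc m) (border_mat 1 U) d (border_mat (d 0) M)"
  using assms unfolding orthogonal_diagonalization_def border_mat_diag[symmetric]
  by (auto simp: transpose_border_mat border_mat_mult[where m = m] border_mat_one)

lemma orthogonal_diagonalization_conjugate:
  assumes diagonalized: "orthogonal_diagonalization n U d A"
    and W: "W \<in> carrier_mat n n" "W\<^sup>T * W = 1\<^sub>m n"
  shows "orthogonal_diagonalization n (W * U) d (W * A * W\<^sup>T)"
proof -
  have U: "U \<in> carrier_mat n n" "U\<^sup>T * U = 1\<^sub>m n" and A_eq: "A = U * mat_diag n d * U\<^sup>T"
    using diagonalized by (auto simp: orthogonal_diagonalization_def)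
  note assoc = assoc_mult_mat[of _ n n _ n _ n]
  have transpose: "(W * U)\<^sup>T = U\<^sup>T * W\<^sup>T" using W(1) U(1) by (rule transpose_mult)
  have "(W * U)\<^sup>T * (W * U) = U\<^sup>T * (W\<^sup>T * W) * U"
    unfolding transpose using W(1) U(1) by (simp add: assoc)
  then have "(W * U)\<^sup>T * (W * U) = 1\<^sub>m n" using W U by simp
  moreover have "W * A * W\<^sup>T = W * U * mat_diag n d * (W * U)\<^sup>T"
  proof -
    have "mat_diag n d * U\<^sup>T \<in> carrier_mat n n" "U * (mat_diag n d * U\<^sup>T) \<in> carrier_mat n n"
      using U(1) by (auto intro!: mult_carrier_mat[of _ n n])
    then show ?thesis unfolding A_eq transpose using W(1) U(1) by (simp add: assoc)
  qed
  ultimately show ?thesis using W(1) U(1) by (simp add: orthogonal_diagonalization_def)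
qed

theorem real_symmetric_spectral_theorem:
  fixes A :: "real mat"
  assumes "A \<in> carrier_mat n n" "A\<^sup>T = A" "char_poly A = (\<Prod>e\<leftarrow>es. [:- e, 1:])"
  shows "\<exists>U. orthogonal_diagonalization n U ((!) es) A"
  using assms
proof (induction es arbitrary: n A)
  case Nil
  then have "n = 0" using degree_monic_char_poly[of A n] by auto
  then show ?case using Nil.prems(1)
    by (intro exI[of _ "1\<^sub>m 0"]) (auto simp: orthogonal_diagonalization_def)
next
  case (Cons e es)
  note carrier = Cons.prems(1)
  have "degree (char_poly A) = Suc (length es)"
    unfolding Cons.prems(3) using degree_linear_factors[of uminus "e # es"] by simp
  then obtain m where n: "n = Suc m" using degree_monic_char_poly[OF carrier] by auto
  have "eigenvalue A e" unfolding eigenvalue_root_char_poly[OF carrier] Cons.prems(3) by simp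
  then obtain W M where W: "W \<in> carrier_mat n n" "W\<^sup>T = W" "W * W = 1\<^sub>m n"
    and M: "M \<in> carrier_mat m m" "M\<^sup>T = M" and A_eq: "A = W * border_mat e M * W"
    using real_symmetric_deflation Cons.prems(1,2) unfolding n by metis
  have "similar_mat_wit A (border_mat e M) W W"
    using carrier W M(1) A_eq n by (intro similar_mat_witI) auto
  then have "char_poly A = [:- e, 1:] * char_poly M"
    unfolding char_poly_border_mat[OF M(1), symmetric]
    by (intro char_poly_similar) (auto simp: similar_mat_def)
  then have "char_poly M = (\<Prod>e\<leftarrow>es. [:- e, 1:])"
    using Cons.prems(3) by (simp del: mult_pCons_left)
  from Cons.IH[OF M this] obtain U where "orthogonal_diagonalization m U ((!) es) M" by blast
  then have "orthogonal_diagonalization n (border_mat 1 U) ((!) (e # es)) (border_mat e M)"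
    using orthogonal_diagonalization_border_mat[of m U "(!) (e # es)" M] unfolding n by simp
  then have "orthogonal_diagonalization n (W * border_mat 1 U) ((!) (e # es))
      (W * border_mat e M * W\<^sup>T)"
    using W by (intro orthogonal_diagonalization_conjugate) auto
  then show ?case unfolding W(2) A_eq[symmetric] by blast
qed

lemma mat_diag_mult_vec:
  assumes "x \<in> carrier_vec n"
  shows "mat_diag n d *\<^sub>v x = vec n (\<lambda>i. d i * x $ i)"
proof (rule eq_vecI)
  fix i assume "i < dim_vec (vec n (\<lambda>i. d i * x $ i))"
  then have i: "i < n" by simp
  have "(mat_diag n d *\<^sub>v x) $ i = (\<Sum>j<n. (if i = j then d j else 0) * x $ j)"
    using i assms by (simp add: mat_diag_def scalar_prod_def atLeast0LessThan)
  also have "\<dots> = (\<Sum>j<n. if i = j then d i * x $ i else 0)" by (intro sum.cong) auto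
  finally show "(mat_diag n d *\<^sub>v x) $ i = vec n (\<lambda>i. d i * x $ i) $ i" using i by simp
qed (simp add: mat_diag_def)

lemma quadratic_form_diagonalized:
  assumes "orthogonal_diagonalization n U d A" and y: "y \<in> carrier_vec n"
  shows "y \<bullet> (A *\<^sub>v y) = (\<Sum>i<n. d i * (col U i \<bullet> y)\<^sup>2)"
proof -
  have U: "U \<in> carrier_mat n n" and A_eq: "A = U * mat_diag n d * U\<^sup>T"
    using assms(1) by (auto simp: orthogonal_diagonalization_def)
  let ?z = "U\<^sup>T *\<^sub>v y"
  have z: "?z \<in> carrier_vec n" using U y by simp
  have "A *\<^sub>v y = U *\<^sub>v (mat_diag n d *\<^sub>v ?z)"
    unfolding A_eq using U y by (simp add: assoc_mult_mat_vec[of _ n n _ n])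
  also have "mat_diag n d *\<^sub>v ?z = vec n (\<lambda>i. d i * ?z $ i)" using z by (rule mat_diag_mult_vec)
  finally have "y \<bullet> (A *\<^sub>v y) = ?z \<bullet> vec n (\<lambda>i. d i * ?z $ i)"
    using transpose_vec_mult_scalar[OF U _ y] by simp
  also have "\<dots> = (\<Sum>i<n. d i * (col U i \<bullet> y)\<^sup>2)"
    using U
    by (auto simp: scalar_prod_def[of ?z] atLeast0LessThan power2_eq_square intro!: sum.cong)
  finally show ?thesis .
qed

lemma scalar_prod_self_eq_sum_col:
  assumes "orthogonal_diagonalization n U d A" and y: "y \<in> carrier_vec n"
  shows "y \<bullet> y = (\<Sum>i<n. (col U i \<bullet> y)\<^sup>2)"
proof -
  have U: "U \<in> carrier_mat n n" "U\<^sup>T * U = 1\<^sub>m n"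
    using assms(1) by (auto simp: orthogonal_diagonalization_def)
  then have "U * U\<^sup>T = 1\<^sub>m n" using mat_mult_left_right_inverse[of "U\<^sup>T" n U] by auto
  then have "orthogonal_diagonalization n U (\<lambda>_. 1) (1\<^sub>m n)"
    using U by (simp add: orthogonal_diagonalization_def)
  from quadratic_form_diagonalized[OF this y] show ?thesis using y by simp
qed

section \<open>Spectral decomposition of the normalized Laplacian\<close>

locale weighted_graph =
  fixes N :: nat and w :: "nat \<Rightarrow> nat \<Rightarrow> real"
  assumes wgraph: "wgraph N w"
begin

definition deg_inner :: "(nat \<Rightarrow> real) \<Rightarrow> (nat \<Rightarrow> real) \<Rightarrow> real" where
  "deg_inner f g = (\<Sum>u<N. deg N w u * f u * g u)"

definition sqnorm :: "(nat \<Rightarrow> real) \<Rightarrow> real" where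
  "sqnorm f = (\<Sum>u<N. deg N w u * (f u)\<^sup>2)"

definition dual_energy :: "(nat \<Rightarrow> real) \<Rightarrow> real" where
  "dual_energy f = (\<Sum>u<N. \<Sum>v<N. w u v * (f u + f v)\<^sup>2)"

definition dual_gap :: "nat \<Rightarrow> real" where
  "dual_gap k = 2 - lambda N w (N - k + 1)"

definition orthonormal :: "nat \<Rightarrow> (nat \<Rightarrow> nat \<Rightarrow> real) \<Rightarrow> bool" where
  "orthonormal k f \<longleftrightarrow> (\<forall>i<k. \<forall>j<k. deg_inner (f i) (f j) = of_bool (i = j))"

definition rayleigh_le :: "(nat \<Rightarrow> real) \<Rightarrow> real \<Rightarrow> bool" where
  "rayleigh_le f c \<longleftrightarrow> 0 < sqnorm f \<and> dual_energy f \<le> c * sqnorm f"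

definition support :: "(nat \<Rightarrow> real) \<Rightarrow> nat set" where
  "support f = {u. u < N \<and> f u \<noteq> 0}"

lemma weight_nonneg: "u < N \<Longrightarrow> v < N \<Longrightarrow> 0 \<le> w u v"
  using wgraph unfolding wgraph_def by blast

lemma weight_commute: "u < N \<Longrightarrow> v < N \<Longrightarrow> w u v = w v u"
  using wgraph unfolding wgraph_def by blast

lemma deg_pos: "u < N \<Longrightarrow> 0 < deg N w u"
  using wgraph unfolding wgraph_def deg_def by blast

lemma deg_nonneg: "u < N \<Longrightarrow> 0 \<le> deg N w u"
  using deg_pos by (simp add: less_imp_le)

lemma deg_inner_self: "deg_inner f f = sqnorm f"
  by (simp add: deg_inner_def sqnorm_def power2_eq_square mult.assoc)

lemma sqnorm_nonneg: "0 \<le> sqnorm f"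
  unfolding sqnorm_def by (intro sum_nonneg) (simp add: deg_nonneg)

lemma dual_energy_nonneg: "0 \<le> dual_energy f"
  unfolding dual_energy_def by (intro sum_nonneg) (simp add: weight_nonneg)

lemma finite_support: "finite (support f)"
  by (simp add: support_def)

lemma support_nonempty_if_sqnorm_pos: "0 < sqnorm f \<Longrightarrow> support f \<noteq> {}"
proof
  assume "0 < sqnorm f" "support f = {}"
  moreover from this have "sqnorm f = 0"
    unfolding sqnorm_def support_def by (intro sum.neutral) auto
  ultimately show False by simp
qed

lemma sum_weights_fst: "(\<Sum>u<N. \<Sum>v<N. w u v * h u) = (\<Sum>u<N. deg N w u * h u)"
  by (simp add: deg_def sum_distrib_right)

lemma sum_weights_snd: "(\<Sum>u<N. \<Sum>v<N. w u v * h v) = (\<Sum>u<N. deg N w u * h u)"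
proof -
  have "(\<Sum>u<N. \<Sum>v<N. w u v * h v) = (\<Sum>v<N. \<Sum>u<N. w v u * h v)"
    by (subst sum.swap) (simp add: weight_commute)
  then show ?thesis by (simp add: sum_weights_fst)
qed

lemma dual_energy_eq:
  "dual_energy f = 2 * sqnorm f + 2 * (\<Sum>u<N. \<Sum>v<N. w u v * f u * f v)"
proof -
  have "dual_energy f = (\<Sum>u<N. \<Sum>v<N. w u v * (f u)\<^sup>2) + (\<Sum>u<N. \<Sum>v<N. w u v * (f v)\<^sup>2)
      + 2 * (\<Sum>u<N. \<Sum>v<N. w u v * f u * f v)"
    unfolding dual_energy_def sum_distrib_left sum.distrib[symmetric]
    by (intro sum.cong refl) (simp add: power2_eq_square algebra_simps)
  then show ?thesis unfolding sum_weights_fst sum_weights_snd sqnorm_def by simp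
qed

lemma dual_energy_le: "dual_energy f \<le> 4 * sqnorm f"
proof -
  have "dual_energy f \<le> (\<Sum>u<N. \<Sum>v<N. w u v * (2 * (f u)\<^sup>2) + w u v * (2 * (f v)\<^sup>2))"
    unfolding dual_energy_def
  proof (intro sum_mono)
    fix u v assume "u \<in> {..<N}" "v \<in> {..<N}"
    moreover have "(f u + f v)\<^sup>2 \<le> 2 * (f u)\<^sup>2 + 2 * (f v)\<^sup>2"
      using zero_le_power2[of "f u - f v"] by (simp add: power2_eq_square algebra_simps)
    ultimately have "w u v * (f u + f v)\<^sup>2 \<le> w u v * (2 * (f u)\<^sup>2 + 2 * (f v)\<^sup>2)"
      by (intro mult_left_mono weight_nonneg) auto
    then show "w u v * (f u + f v)\<^sup>2 \<le> w u v * (2 * (f u)\<^sup>2) + w u v * (2 * (f v)\<^sup>2)"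
      by (simp only: distrib_left)
  qed
  also have "\<dots> = (\<Sum>u<N. deg N w u * (2 * (f u)\<^sup>2)) + (\<Sum>u<N. deg N w u * (2 * (f u)\<^sup>2))"
    unfolding sum.distrib sum_weights_fst sum_weights_snd ..
  also have "\<dots> = 4 * sqnorm f"
    unfolding sqnorm_def sum_distrib_left sum.distrib[symmetric] by (intro sum.cong) auto
  finally show ?thesis .
qed

definition sym_laplacian :: "real mat" where
  "sym_laplacian = mat N N
     (\<lambda>(u, v). of_bool (u = v) - w u v / (sqrt (deg N w u) * sqrt (deg N w v)))"

lemma sym_laplacian_carrier [simp]: "sym_laplacian \<in> carrier_mat N N"
  by (simp add: sym_laplacian_def)

lemma transpose_sym_laplacian: "sym_laplacian\<^sup>T = sym_laplacian"
  by (intro eq_matI) (auto simp: sym_laplacian_def weight_commute mult.commute)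

lemma char_poly_norm_laplacian: "char_poly (norm_laplacian N w) = char_poly sym_laplacian"
proof (rule char_poly_similar)
  let ?P = "mat_diag N (\<lambda>u. 1 / sqrt (deg N w u))" and ?Q = "mat_diag N (\<lambda>u. sqrt (deg N w u))"
  have sqrt_deg: "sqrt (deg N w u) \<noteq> 0" "sqrt (deg N w u) * sqrt (deg N w u) = deg N w u"
    if "u < N" for u
    using deg_pos[OF that] by auto
  have "norm_laplacian N w = ?P * sym_laplacian * ?Q"
  proof (rule eq_matI)
    fix u v assume "u < dim_row (?P * sym_laplacian * ?Q)" "v < dim_col (?P * sym_laplacian * ?Q)"
    then have uv: "u < N" "v < N" by (auto simp: mat_diag_def)
    have "(?P * sym_laplacian * ?Q) $$ (u, v)
        = 1 / sqrt (deg N w u) * sym_laplacian $$ (u, v) * sqrt (deg N w v)"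
      unfolding mat_diag_mult_left[OF sym_laplacian_carrier]
      by (subst mat_diag_mult_right[of _ N]) (use uv in auto)
    also have "\<dots> = of_bool (u = v) - w u v / (sqrt (deg N w u) * sqrt (deg N w u))"
      using uv sqrt_deg(1)[OF uv(1)] sqrt_deg(1)[OF uv(2)]
      by (simp add: sym_laplacian_def field_simps)
    finally show "norm_laplacian N w $$ (u, v) = (?P * sym_laplacian * ?Q) $$ (u, v)"
      unfolding sqrt_deg(2)[OF uv(1)] using uv by (simp add: norm_laplacian_def)
  qed (auto simp: norm_laplacian_def mat_diag_def)
  moreover have "?P * ?Q = 1\<^sub>m N" "?Q * ?P = 1\<^sub>m N"
    unfolding mat_diag_diag using sqrt_deg(1) by (auto simp: mat_diag_def intro!: eq_matI)
  moreover have "norm_laplacian N w \<in> carrier_mat N N" by (simp add: norm_laplacian_def)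
  ultimately have "similar_mat_wit (norm_laplacian N w) sym_laplacian ?P ?Q"
    by (intro similar_mat_witI) auto
  then show "similar_mat (norm_laplacian N w) sym_laplacian" unfolding similar_mat_def by blast
qed

lemma laplacian_eigenvalues_unique:
  "\<exists>!xs. sorted xs \<and> length xs = N \<and> char_poly (norm_laplacian N w) = (\<Prod>x\<leftarrow>xs. [:- x, 1:])"
proof -
  obtain es where es: "length es = N" "char_poly sym_laplacian = (\<Prod>x\<leftarrow>es. [:- x, 1:])"
    using real_symmetric_char_poly_splits[OF sym_laplacian_carrier transpose_sym_laplacian] by blast
  show ?thesis
  proof (intro ex1I[of _ "sort es"] conjI)
    have "(\<Prod>x\<leftarrow>sort es. [:- x, 1:]) = (\<Prod>x\<leftarrow>es. [:- x, 1:])" by (simp flip: prod_mset_prod_list)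
    then show "char_poly (norm_laplacian N w) = (\<Prod>x\<leftarrow>sort es. [:- x, 1:])"
      using es(2) char_poly_norm_laplacian by simp
    fix xs assume "sorted xs \<and> length xs = N \<and> char_poly (norm_laplacian N w) = (\<Prod>x\<leftarrow>xs. [:- x, 1:])"
    then show "xs = sort es"
      using es(2) char_poly_norm_laplacian linear_factors_unique[of xs es]
        properties_for_sort[of xs es]
      by simp
  qed (use es(1) in auto)
qed

lemma laplacian_eigenvalues_properties:
  shows "sorted (laplacian_eigenvalues N w)" "length (laplacian_eigenvalues N w) = N"
    "char_poly sym_laplacian = (\<Prod>x\<leftarrow>laplacian_eigenvalues N w. [:- x, 1:])"
  using theI'[OF laplacian_eigenvalues_unique] char_poly_norm_laplacian
  unfolding laplacian_eigenvalues_def by auto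

lemma dual_gap_eq_eigenvalue:
  "1 \<le> k \<Longrightarrow> k \<le> N \<Longrightarrow> dual_gap k = 2 - laplacian_eigenvalues N w ! (N - k)"
  by (simp add: dual_gap_def lambda_def)

lemma dual_gap_mono: "1 \<le> k \<Longrightarrow> k \<le> l \<Longrightarrow> l \<le> N \<Longrightarrow> dual_gap k \<le> dual_gap l"
  using laplacian_eigenvalues_properties(1,2) by (simp add: dual_gap_eq_eigenvalue sorted_nth_mono)

definition deg_vec :: "(nat \<Rightarrow> real) \<Rightarrow> real vec" where
  "deg_vec f = vec N (\<lambda>u. sqrt (deg N w u) * f u)"

lemma deg_vec_carrier [simp]: "deg_vec f \<in> carrier_vec N"
  by (simp add: deg_vec_def)

lemma deg_inner_eq_scalar_prod: "deg_inner f g = deg_vec f \<bullet> deg_vec g"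
proof -
  have "deg_vec f \<bullet> deg_vec g = (\<Sum>u<N. (sqrt (deg N w u) * sqrt (deg N w u)) * f u * g u)"
    by (simp add: deg_vec_def scalar_prod_def atLeast0LessThan mult_ac)
  also have "\<dots> = deg_inner f g"
    unfolding deg_inner_def by (intro sum.cong) (simp_all add: deg_nonneg)
  finally show ?thesis ..
qed

lemma dual_energy_eq_sym_laplacian_form:
  "dual_energy g = 4 * sqnorm g - 2 * (deg_vec g \<bullet> (sym_laplacian *\<^sub>v deg_vec g))"
proof -
  let ?y = "deg_vec g"
  have entry: "?y $ u * (sym_laplacian $$ (u, v) * ?y $ v)
      = (if v = u then deg N w u * (g u)\<^sup>2 else 0) - w u v * g u * g v" if "u < N" "v < N" for u v
    using that deg_pos[of u] deg_pos[of v]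
    by (auto simp: sym_laplacian_def deg_vec_def power2_eq_square field_simps)
  have "?y \<bullet> (sym_laplacian *\<^sub>v ?y) = (\<Sum>u<N. \<Sum>v<N. ?y $ u * (sym_laplacian $$ (u, v) * ?y $ v))"
    by (auto simp: scalar_prod_def deg_vec_def sym_laplacian_def atLeast0LessThan sum_distrib_left
        intro!: sum.cong)
  also have "\<dots> = sqnorm g - (\<Sum>u<N. \<Sum>v<N. w u v * g u * g v)"
    using entry by (simp add: sum_subtractf sqnorm_def)
  finally show ?thesis unfolding dual_energy_eq by simp
qed

definition dual_eigenbasis :: "(nat \<Rightarrow> nat \<Rightarrow> real) \<Rightarrow> bool" where
  "dual_eigenbasis f \<longleftrightarrow> orthonormal N f \<and>
     (\<forall>g. sqnorm g = (\<Sum>i<N. (deg_inner g (f i))\<^sup>2)) \<and>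
     (\<forall>g. dual_energy g = 2 * (\<Sum>i<N. dual_gap (Suc i) * (deg_inner g (f i))\<^sup>2))"

lemma dual_eigenbasis_exists: "\<exists>f. dual_eigenbasis f"
proof -
  let ?ev = "laplacian_eigenvalues N w"
  obtain U where diagonalized: "orthogonal_diagonalization N U ((!) ?ev) sym_laplacian"
    using real_symmetric_spectral_theorem[OF sym_laplacian_carrier transpose_sym_laplacian
        laplacian_eigenvalues_properties(3)] by blast
  then have U: "U \<in> carrier_mat N N" "U\<^sup>T * U = 1\<^sub>m N"
    by (auto simp: orthogonal_diagonalization_def)
  define f where "f i u = U $$ (u, N - Suc i) / sqrt (deg N w u)" for i u
  have deg_vec_f: "deg_vec (f i) = col U (N - Suc i)" if "i < N" for i
    using that U(1) deg_pos[THEN less_imp_neq] by (intro eq_vecI) (auto simp: deg_vec_def f_def)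
  have coefficient: "col U (N - Suc i) \<bullet> deg_vec g = deg_inner g (f i)" if "i < N" for i g
    unfolding deg_inner_eq_scalar_prod deg_vec_f[OF that, symmetric]
    by (rule comm_scalar_prod[of _ N]) simp_all
  have reindex:
    "(\<Sum>i<N. d i * (col U i \<bullet> deg_vec g)\<^sup>2) = (\<Sum>i<N. d (N - Suc i) * (deg_inner g (f i))\<^sup>2)"
    for d g
    by (subst sum.nat_diff_reindex[symmetric]) (simp add: coefficient)
  have parseval: "sqnorm g = (\<Sum>i<N. (deg_inner g (f i))\<^sup>2)" for g
    using scalar_prod_self_eq_sum_col[OF diagonalized, of "deg_vec g"] reindex[of "\<lambda>_. 1" g]
    by (simp flip: deg_inner_self deg_inner_eq_scalar_prod)
  have "deg_vec g \<bullet> (sym_laplacian *\<^sub>v deg_vec g)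
      = (\<Sum>i<N. ?ev ! (N - Suc i) * (deg_inner g (f i))\<^sup>2)" for g
    using quadratic_form_diagonalized[OF diagonalized, of "deg_vec g"] reindex[of "(!) ?ev" g]
    by simp
  then have energy: "dual_energy g = 2 * (\<Sum>i<N. dual_gap (Suc i) * (deg_inner g (f i))\<^sup>2)" for g
    unfolding dual_energy_eq_sym_laplacian_form parseval
    by (simp add: dual_gap_eq_eigenvalue sum_distrib_left sum_subtractf[symmetric] algebra_simps)
  have "deg_inner (f i) (f j) = of_bool (i = j)" if "i < N" "j < N" for i j
  proof -
    have "deg_inner (f i) (f j) = (U\<^sup>T * U) $$ (N - Suc i, N - Suc j)"
      using that U(1) by (simp add: deg_inner_eq_scalar_prod deg_vec_f)
    then show ?thesis unfolding U(2) using that by auto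
  qed
  then show ?thesis using parseval energy unfolding dual_eigenbasis_def orthonormal_def by blast
qed

lemma dual_gap_eigenfunctions:
  assumes "k \<le> N"
  obtains f where "orthonormal k f" "\<And>i. i < k \<Longrightarrow> dual_energy (f i) = 2 * dual_gap (Suc i)"
proof -
  obtain f where "dual_eigenbasis f" using dual_eigenbasis_exists by blast
  then have orthonormal: "orthonormal N f"
    and energy: "dual_energy g = 2 * (\<Sum>i<N. dual_gap (Suc i) * (deg_inner g (f i))\<^sup>2)" for g
    unfolding dual_eigenbasis_def by blast+
  have "dual_energy (f i) = 2 * (\<Sum>j<N. if j = i then dual_gap (Suc i) else 0)" if "i < k" for i
    unfolding energy using orthonormal that assms
    by (intro arg_cong[of _ _ "(*) 2"] sum.cong) (auto simp: orthonormal_def)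
  then have "dual_energy (f i) = 2 * dual_gap (Suc i)" if "i < k" for i
    using that assms by simp
  moreover have "orthonormal k f" using orthonormal assms by (simp add: orthonormal_def)
  ultimately show ?thesis using that by blast
qed

lemma dual_gap_bounds:
  assumes "1 \<le> k" "k \<le> N"
  shows "0 \<le> dual_gap k" "dual_gap k \<le> 2"
proof -
  obtain f where f: "orthonormal k f" "\<And>i. i < k \<Longrightarrow> dual_energy (f i) = 2 * dual_gap (Suc i)"
    by (rule dual_gap_eigenfunctions[OF assms(2)]) blast
  have "dual_energy (f (k - 1)) = 2 * dual_gap k" "sqnorm (f (k - 1)) = 1"
    using f assms(1) by (auto simp: orthonormal_def simp flip: deg_inner_self)
  then show "0 \<le> dual_gap k" "dual_gap k \<le> 2"
    using dual_energy_nonneg[of "f (k - 1)"] dual_energy_le[of "f (k - 1)"] by auto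
qed

end

lemma underdetermined_system_solution:
  fixes a :: "nat \<Rightarrow> nat \<Rightarrow> 'a::field"
  assumes "m < n"
  obtains x where "\<exists>j<n. x j \<noteq> 0" "\<And>i. i < m \<Longrightarrow> (\<Sum>j<n. a i j * x j) = 0"
proof -
  define M where "M = mat n n (\<lambda>(i, j). if i < m then a i j else 0)"
  have M: "M \<in> carrier_mat n n" by (simp add: M_def)
  have "M\<^sup>T *\<^sub>v unit_vec n m = 0\<^sub>v n"
    using assms by (intro eq_vecI) (auto simp: M_def scalar_prod_def intro!: sum.neutral)
  moreover have "unit_vec n m \<noteq> (0\<^sub>v n :: 'a vec)" using assms by simp
  ultimately have "det (M\<^sup>T) = 0"
    using det_0_iff_vec_prod_zero[of "M\<^sup>T" n] M by (metis transpose_carrier_mat unit_vec_carrier)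
  then have "det M = 0" using det_transpose[OF M] by simp
  then obtain x where x: "x \<in> carrier_vec n" "x \<noteq> 0\<^sub>v n" "M *\<^sub>v x = 0\<^sub>v n"
    using det_0_iff_vec_prod_zero[OF M] by blast
  have "\<exists>j<n. x $ j \<noteq> 0"
  proof (rule ccontr)
    assume "\<not> ?thesis"
    then have "x = 0\<^sub>v n" using x(1) by (intro eq_vecI) auto
    then show False using x(2) by simp
  qed
  moreover have "(\<Sum>j<n. a i j * x $ j) = 0" if "i < m" for i
  proof -
    have "(M *\<^sub>v x) $ i = (\<Sum>j<n. a i j * x $ j)"
      using that assms x(1) by (auto simp: M_def scalar_prod_def atLeast0LessThan)
    then show ?thesis using x(3) that assms by simp
  qed
  ultimately show ?thesis using that by blast
qed

lemma square_sum_pairwise_orthogonal: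
  fixes x :: "'i \<Rightarrow> 'a::comm_ring_1"
  assumes "finite J" and "pairwise (\<lambda>i j. x i * x j = 0) J"
  shows "(\<Sum>j\<in>J. x j)\<^sup>2 = (\<Sum>j\<in>J. (x j)\<^sup>2)"
proof -
  have "(\<Sum>j\<in>J. x j)\<^sup>2 = (\<Sum>i\<in>J. \<Sum>j\<in>J. if j = i then (x i)\<^sup>2 else 0)"
    unfolding power2_eq_square sum_product using assms(2)
    by (intro sum.cong refl) (auto simp: pairwise_def)
  then show ?thesis using assms(1) by simp
qed

lemma square_sum_add_le:
  fixes x y :: "'i \<Rightarrow> real"
  assumes "finite J" and x_orthogonal: "pairwise (\<lambda>i j. x i * x j = 0) J"
    and y_orthogonal: "pairwise (\<lambda>i j. y i * y j = 0) J"
  shows "(\<Sum>j\<in>J. x j + y j)\<^sup>2 \<le> 2 * (\<Sum>j\<in>J. (x j + y j)\<^sup>2)"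
proof -
  define A where "A z = {j\<in>J. z j \<noteq> 0}" for z :: "'i \<Rightarrow> real"
  have card_le_1: "card (A z) \<le> 1" if "pairwise (\<lambda>i j. z i * z j = 0) J" for z
  proof -
    have "\<forall>i\<in>A z. \<forall>j\<in>A z. i = j" using that by (auto simp: A_def pairwise_def)
    then show ?thesis using assms(1) by (simp add: card_le_Suc0_iff_eq A_def)
  qed
  have "card (A x \<union> A y) \<le> 2"
    using card_Un_le[of "A x" "A y"] card_le_1[OF x_orthogonal] card_le_1[OF y_orthogonal] by simp
  have "(\<Sum>j\<in>J. x j + y j)\<^sup>2 = (\<Sum>j\<in>A x \<union> A y. x j + y j)\<^sup>2"
    using assms(1) by (intro arg_cong[of _ _ power2] sum.mono_neutral_right) (auto simp: A_def)
  also have "\<dots> \<le> (\<Sum>j\<in>A x \<union> A y. (x j + y j)\<^sup>2) * card (A x \<union> A y)"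
    by (rule sum_squared_le_sum_of_squares)
  also have "\<dots> \<le> (\<Sum>j\<in>J. (x j + y j)\<^sup>2) * 2"
    using assms(1) \<open>card (A x \<union> A y) \<le> 2\<close>
    by (intro mult_mono sum_mono2 sum_nonneg) (auto simp: A_def)
  finally show ?thesis by simp
qed

context weighted_graph
begin

lemma disjoint_supports_pairwise_orthogonal:
  assumes "disjoint_family_on (\<lambda>j. support (g j)) J" "u < N"
  shows "pairwise (\<lambda>i j. g i u * g j u = 0) J"
  using assms by (fastforce simp: pairwise_def disjoint_family_on_def support_def)

lemma sqnorm_sum_disjoint_supports:
  assumes "finite J" "disjoint_family_on (\<lambda>j. support (g j)) J"
  shows "sqnorm (\<lambda>u. \<Sum>j\<in>J. g j u) = (\<Sum>j\<in>J. sqnorm (g j))"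
proof -
  have "sqnorm (\<lambda>u. \<Sum>j\<in>J. g j u) = (\<Sum>u<N. \<Sum>j\<in>J. deg N w u * (g j u)\<^sup>2)"
    unfolding sqnorm_def
    using square_sum_pairwise_orthogonal[OF assms(1)
        disjoint_supports_pairwise_orthogonal[OF assms(2)]]
    by (intro sum.cong refl) (simp add: sum_distrib_left)
  then show ?thesis unfolding sqnorm_def by (simp add: sum.swap[of _ J])
qed

lemma sum_dual_energy:
  "(\<Sum>j\<in>J. dual_energy (g j)) = (\<Sum>u<N. \<Sum>v<N. w u v * (\<Sum>j\<in>J. (g j u + g j v)\<^sup>2))"
  unfolding dual_energy_def sum_distrib_left by (simp only: sum.swap[of _ _ J])

lemma dual_energy_sum_disjoint_supports_le:
  assumes "finite J" "disjoint_family_on (\<lambda>j. support (g j)) J"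
  shows "dual_energy (\<lambda>u. \<Sum>j\<in>J. g j u) \<le> 2 * (\<Sum>j\<in>J. dual_energy (g j))"
proof -
  have "dual_energy (\<lambda>u. \<Sum>j\<in>J. g j u) \<le> (\<Sum>u<N. \<Sum>v<N. w u v * (2 * (\<Sum>j\<in>J. (g j u + g j v)\<^sup>2)))"
    unfolding dual_energy_def sum.distrib[symmetric]
    using assms disjoint_supports_pairwise_orthogonal[OF assms(2)]
    by (intro sum_mono mult_left_mono square_sum_add_le) (auto simp: weight_nonneg)
  also have "\<dots> = 2 * (\<Sum>j\<in>J. dual_energy (g j))"
    unfolding sum_dual_energy by (simp add: sum_distrib_left mult.left_commute)
  finally show ?thesis .
qed

lemma dual_gap_le_rayleigh_in_span:
  assumes l_range: "1 \<le> l" "l \<le> N"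
  obtains a where "\<exists>j<l. a j \<noteq> 0"
    "2 * dual_gap l * sqnorm (\<lambda>u. \<Sum>j<l. a j * g j u) \<le> dual_energy (\<lambda>u. \<Sum>j<l. a j * g j u)"
proof -
  obtain f where "dual_eigenbasis f" using dual_eigenbasis_exists by blast
  then have parseval: "sqnorm h = (\<Sum>i<N. (deg_inner h (f i))\<^sup>2)"
    and energy: "dual_energy h = 2 * (\<Sum>i<N. dual_gap (Suc i) * (deg_inner h (f i))\<^sup>2)" for h
    unfolding dual_eigenbasis_def by blast+
  have "l - 1 < l" using l_range by simp
  then obtain a where nontrivial: "\<exists>j<l. a j \<noteq> 0"
    and system: "\<And>i. i < l - 1 \<Longrightarrow> (\<Sum>j<l. deg_inner (g j) (f i) * a j) = 0"
    using underdetermined_system_solution[of "l - 1" l "\<lambda>i j. deg_inner (g j) (f i)"] by blast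
  define h where "h u = (\<Sum>j<l. a j * g j u)" for u
  have "deg_inner h (f i) = (\<Sum>j<l. deg_inner (g j) (f i) * a j)" for i
    unfolding deg_inner_def h_def sum_distrib_left sum_distrib_right
    by (subst sum.swap) (simp add: mult_ac)
  then have orthogonal: "deg_inner h (f i) = 0" if "i < l - 1" for i using system[OF that] by simp
  have "dual_gap l * (deg_inner h (f i))\<^sup>2 \<le> dual_gap (Suc i) * (deg_inner h (f i))\<^sup>2"
    if "i < N" for i
  proof (cases "i < l - 1")
    case False
    then show ?thesis using dual_gap_mono[of l "Suc i"] l_range that by (intro mult_right_mono) auto
  qed (simp add: orthogonal)
  then have "dual_gap l * sqnorm h \<le> (\<Sum>i<N. dual_gap (Suc i) * (deg_inner h (f i))\<^sup>2)"
    unfolding parseval sum_distrib_left by (intro sum_mono) auto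
  then have "2 * dual_gap l * sqnorm h \<le> dual_energy h" unfolding energy by simp
  then show ?thesis using nontrivial that unfolding h_def by blast
qed

lemma dual_gap_le_disjoint_supports:
  assumes l_range: "1 \<le> l" "l \<le> N" and disjoint: "disjoint_family_on (\<lambda>j. support (g j)) {..<l}"
    and rayleigh: "\<And>j. j < l \<Longrightarrow> rayleigh_le (g j) c"
  shows "dual_gap l \<le> c"
proof -
  obtain a where nontrivial: "\<exists>j<l. a j \<noteq> 0" and
    form_le: "2 * dual_gap l * sqnorm (\<lambda>u. \<Sum>j<l. a j * g j u) \<le> dual_energy (\<lambda>u. \<Sum>j<l. a j * g j u)"
    by (rule dual_gap_le_rayleigh_in_span[OF l_range])
  define h where "h = (\<lambda>u. \<Sum>j<l. a j * g j u)"
  have disjoint_scaled: "disjoint_family_on (\<lambda>j. support (\<lambda>u. a j * g j u)) {..<l}"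
    using disjoint by (auto simp: disjoint_family_on_def support_def)
  have sqnorm_scale: "sqnorm (\<lambda>u. a j * g j u) = (a j)\<^sup>2 * sqnorm (g j)" for j
    by (simp add: sqnorm_def power_mult_distrib sum_distrib_left mult_ac)
  have energy_scale: "dual_energy (\<lambda>u. a j * g j u) = (a j)\<^sup>2 * dual_energy (g j)" for j
    by (simp add: dual_energy_def power_mult_distrib sum_distrib_left mult_ac flip: distrib_left)
  have sqnorm_h: "sqnorm h = (\<Sum>j<l. (a j)\<^sup>2 * sqnorm (g j))"
    unfolding h_def
    using sqnorm_sum_disjoint_supports[OF _ disjoint_scaled] by (simp add: sqnorm_scale)
  obtain j where j: "j < l" "a j \<noteq> 0" using nontrivial by blast
  have "0 < (a j)\<^sup>2 * sqnorm (g j)" using j rayleigh by (simp add: rayleigh_le_def)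
  also have "\<dots> \<le> sqnorm h" unfolding sqnorm_h using j sqnorm_nonneg by (intro member_le_sum) auto
  finally have "0 < sqnorm h" .
  have "2 * dual_gap l * sqnorm h \<le> dual_energy h" using form_le unfolding h_def .
  also have "\<dots> \<le> 2 * (\<Sum>j<l. (a j)\<^sup>2 * dual_energy (g j))"
    unfolding h_def using dual_energy_sum_disjoint_supports_le[OF _ disjoint_scaled]
    by (simp add: energy_scale)
  also have "\<dots> \<le> 2 * (\<Sum>j<l. (a j)\<^sup>2 * (c * sqnorm (g j)))"
    using rayleigh by (intro mult_left_mono sum_mono) (auto simp: rayleigh_le_def)
  also have "\<dots> = 2 * c * sqnorm h" by (simp add: sqnorm_h sum_distrib_left mult_ac)
  finally show ?thesis using \<open>0 < sqnorm h\<close> by simp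
qed

end

section \<open>The improved dual Cheeger inequality\<close>

lemma abs_peel:
  fixes x m :: real
  assumes "0 \<le> m" "x \<noteq> 0 \<Longrightarrow> m \<le> \<bar>x\<bar>"
  shows "\<bar>x\<bar> = \<bar>x - m * sgn x\<bar> + m * \<bar>sgn x\<bar>"
  using assms by (cases x "0 :: real" rule: linorder_cases) auto

lemma abs_add_peel:
  fixes x y m :: real
  assumes "0 \<le> m" "x \<noteq> 0 \<Longrightarrow> m \<le> \<bar>x\<bar>" "y \<noteq> 0 \<Longrightarrow> m \<le> \<bar>y\<bar>"
  shows "\<bar>x + y\<bar> = \<bar>(x - m * sgn x) + (y - m * sgn y)\<bar> + m * \<bar>sgn x + sgn y\<bar>"
  using assms
  by (cases x "0 :: real" rule: linorder_cases; cases y "0 :: real" rule: linorder_cases) auto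

context weighted_graph
begin

definition dual_variation :: "(nat \<Rightarrow> real) \<Rightarrow> real" where
  "dual_variation h = (\<Sum>u<N. \<Sum>v<N. w u v * \<bar>h u + h v\<bar>)"

definition l1norm :: "(nat \<Rightarrow> real) \<Rightarrow> real" where
  "l1norm h = (\<Sum>u<N. deg N w u * \<bar>h u\<bar>)"

definition almost_bipartite :: "nat set \<Rightarrow> real \<Rightarrow> bool" where
  "almost_bipartite S \<epsilon> \<longleftrightarrow>
     (\<exists>A B. A \<union> B \<subseteq> S \<and> A \<inter> B = {} \<and> A \<union> B \<noteq> {} \<and> 1 - phibar N w A B \<le> \<epsilon>)"

lemma almost_bipartite_mono: "almost_bipartite S \<epsilon> \<Longrightarrow> \<epsilon> \<le> \<delta> \<Longrightarrow> almost_bipartite S \<delta>"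
  unfolding almost_bipartite_def using order_trans by blast

lemma l1norm_nonneg: "0 \<le> l1norm h"
  unfolding l1norm_def by (intro sum_nonneg) (simp add: deg_nonneg)

lemma dual_variation_nonneg: "0 \<le> dual_variation h"
  unfolding dual_variation_def by (intro sum_nonneg) (simp add: weight_nonneg)

lemma l1norm_pos: "support h \<noteq> {} \<Longrightarrow> 0 < l1norm h"
  unfolding l1norm_def support_def using deg_pos deg_nonneg
  by (auto intro!: sum_pos2 simp: zero_less_mult_iff)

lemma edges_between_eq_sum_of_bool:
  assumes "A \<subseteq> {..<N}" "B \<subseteq> {..<N}"
  shows "edges_between w A B = (\<Sum>u<N. \<Sum>v<N. w u v * (of_bool (u \<in> A) * of_bool (v \<in> B)))"
proof -
  have restrict: "(\<Sum>u\<in>X. g u) = (\<Sum>u<N. of_bool (u \<in> X) * g u)"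
    if "X \<subseteq> {..<N}" for X and g :: "nat \<Rightarrow> real"
    using that by (intro sum.mono_neutral_cong_left) auto
  show ?thesis
    unfolding edges_between_def restrict[OF assms(1)] restrict[OF assms(2)] sum_distrib_left
    by (simp only: mult_ac)
qed

lemma edges_between_commute:
  "A \<subseteq> {..<N} \<Longrightarrow> B \<subseteq> {..<N} \<Longrightarrow> edges_between w B A = edges_between w A B"
  unfolding edges_between_def
  by (subst sum.swap) (auto simp: weight_commute subset_iff intro!: sum.cong)

lemma dual_variation_sgn:
  fixes h :: "nat \<Rightarrow> real"
  defines "A \<equiv> {u. u < N \<and> 0 < h u}" and "B \<equiv> {u. u < N \<and> h u < 0}"
  assumes nonempty: "support h \<noteq> {}"
  shows "dual_variation (\<lambda>u. sgn (h u)) = 2 * (1 - phibar N w A B) * l1norm (\<lambda>u. sgn (h u))"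
proof -
  have AB: "A \<subseteq> {..<N}" "B \<subseteq> {..<N}" by (auto simp: A_def B_def)
  have vol: "vol N w (A \<union> B) = l1norm (\<lambda>u. sgn (h u))"
    unfolding vol_def l1norm_def A_def B_def
    by (rule sum.mono_neutral_cong_left) (auto simp: sgn_real_def)
  have "support (\<lambda>u. sgn (h u)) \<noteq> {}" using nonempty by (simp add: support_def sgn_zero_iff)
  then have vol_pos: "0 < vol N w (A \<union> B)" unfolding vol by (rule l1norm_pos)
  have "dual_variation (\<lambda>u. sgn (h u)) = (\<Sum>u<N. \<Sum>v<N. w u v * \<bar>sgn (h u)\<bar> + w u v * \<bar>sgn (h v)\<bar>
      - 2 * (w u v * (of_bool (u \<in> A) * of_bool (v \<in> B)))
      - 2 * (w u v * (of_bool (u \<in> B) * of_bool (v \<in> A))))"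
    unfolding dual_variation_def by (intro sum.cong refl) (auto simp: A_def B_def sgn_real_def)
  also have "\<dots> = 2 * vol N w (A \<union> B) - 4 * edges_between w A B"
    unfolding sum_subtractf sum.distrib sum_distrib_left[symmetric] sum_weights_fst sum_weights_snd
      edges_between_eq_sum_of_bool[OF AB, symmetric]
      edges_between_eq_sum_of_bool[OF AB(2,1), symmetric]
      edges_between_commute[OF AB] vol l1norm_def
    by simp
  also have "\<dots> = 2 * (1 - phibar N w A B) * vol N w (A \<union> B)"
    using vol_pos unfolding phibar_def by (simp add: field_simps)
  finally show ?thesis unfolding vol .
qed

lemma l1norm_peel:
  assumes "0 \<le> m" "\<And>u. u < N \<Longrightarrow> h u \<noteq> 0 \<Longrightarrow> m \<le> \<bar>h u\<bar>"
  shows "l1norm h = l1norm (\<lambda>u. h u - m * sgn (h u)) + m * l1norm (\<lambda>u. sgn (h u))"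
  unfolding l1norm_def sum_distrib_left sum.distrib[symmetric]
  using abs_peel[OF assms] by (intro sum.cong refl) (simp add: algebra_simps)

lemma dual_variation_peel:
  assumes "0 \<le> m" "\<And>u. u < N \<Longrightarrow> h u \<noteq> 0 \<Longrightarrow> m \<le> \<bar>h u\<bar>"
  shows "dual_variation h
    = dual_variation (\<lambda>u. h u - m * sgn (h u)) + m * dual_variation (\<lambda>u. sgn (h u))"
  unfolding dual_variation_def sum_distrib_left sum.distrib[symmetric]
  using abs_add_peel[OF assms assms(2)] by (intro sum.cong refl) (simp add: algebra_simps)

lemma peel_minimum:
  assumes "support h \<noteq> {}"
  obtains m where "0 < m" "\<And>u. u < N \<Longrightarrow> h u \<noteq> 0 \<Longrightarrow> m \<le> \<bar>h u\<bar>"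
    "support (\<lambda>u. h u - m * sgn (h u)) \<subset> support h"
proof (rule that)
  let ?m = "Min ((\<lambda>u. \<bar>h u\<bar>) ` support h)"
  obtain p where p: "p \<in> support h" "?m = \<bar>h p\<bar>" by (rule obtains_MIN[OF finite_support assms])
  show "0 < ?m" using p by (simp add: support_def)
  show "?m \<le> \<bar>h u\<bar>" if "u < N" "h u \<noteq> 0" for u
    using that finite_support by (intro Min_le) (auto simp: support_def)
  have "p \<notin> support (\<lambda>u. h u - ?m * sgn (h u))" using p(2) by (simp add: support_def abs_mult_sgn)
  then show "support (\<lambda>u. h u - ?m * sgn (h u)) \<subset> support h" using p(1) by (auto simp: support_def)
qed

lemma dual_variation_ge_expansion:
  assumes "\<And>A B. A \<union> B \<subseteq> support h \<Longrightarrow> A \<inter> B = {} \<Longrightarrow> A \<union> B \<noteq> {} \<Longrightarrow> x \<le> 1 - phibar N w A B"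
  shows "2 * x * l1norm h \<le> dual_variation h"
  using assms
proof (induction "card (support h)" arbitrary: h rule: less_induct)
  case less
  show ?case
  proof (cases "support h = {}")
    case True
    then have "l1norm h = 0" unfolding l1norm_def support_def by (intro sum.neutral) auto
    then show ?thesis using dual_variation_nonneg by simp
  next
    case False
    obtain m where m_pos: "0 < m" and m_le: "\<And>u. u < N \<Longrightarrow> h u \<noteq> 0 \<Longrightarrow> m \<le> \<bar>h u\<bar>"
      and smaller: "support (\<lambda>u. h u - m * sgn (h u)) \<subset> support h"
      by (rule peel_minimum[OF False]) blast
    let ?h' = "\<lambda>u. h u - m * sgn (h u)" and ?s = "\<lambda>u. sgn (h u)"
    let ?A = "{u. u < N \<and> 0 < h u}" and ?B = "{u. u < N \<and> h u < 0}"
    have "2 * x * l1norm ?h' \<le> dual_variation ?h'"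
    proof (rule less.hyps)
      show "card (support ?h') < card (support h)"
        using finite_support smaller by (rule psubset_card_mono)
      show "x \<le> 1 - phibar N w A B"
        if "A \<union> B \<subseteq> support ?h'" "A \<inter> B = {}" "A \<union> B \<noteq> {}" for A B
        using that smaller by (intro less.prems) auto
    qed
    moreover have "2 * x * (m * l1norm ?s) \<le> m * dual_variation ?s"
    proof -
      have "x \<le> 1 - phibar N w ?A ?B"
        using False by (intro less.prems) (auto simp: support_def neq_iff)
      then have "x * (2 * m * l1norm ?s) \<le> (1 - phibar N w ?A ?B) * (2 * m * l1norm ?s)"
        using m_pos l1norm_nonneg by (intro mult_right_mono) auto
      then show ?thesis unfolding dual_variation_sgn[OF False] by (simp only: mult_ac)
    qed
    moreover have "l1norm h = l1norm ?h' + m * l1norm ?s"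
      and "dual_variation h = dual_variation ?h' + m * dual_variation ?s"
      using m_pos m_le by (auto intro: l1norm_peel dual_variation_peel)
    ultimately show ?thesis by (simp only: distrib_left add_mono)
  qed
qed

lemma signed_sweep:
  assumes "support h \<noteq> {}"
  shows "almost_bipartite (support h) (dual_variation h / (2 * l1norm h))"
proof -
  define P where "P = {(A, B). A \<union> B \<subseteq> support h \<and> A \<inter> B = {} \<and> A \<union> B \<noteq> {}}"
  let ?defect = "\<lambda>(A, B). 1 - phibar N w A B"
  have "P \<subseteq> Pow (support h) \<times> Pow (support h)" unfolding P_def by auto
  then have "finite P" using finite_support[of h] by (auto intro: finite_subset)
  moreover have "(support h, {}) \<in> P" using assms by (simp add: P_def)
  ultimately obtain A B where AB: "(A, B) \<in> P" "\<And>p. p \<in> P \<Longrightarrow> ?defect (A, B) \<le> ?defect p"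
    using arg_min_if_finite[of P ?defect] by (metis empty_iff linorder_not_less surj_pair)
  have minimal: "1 - phibar N w A B \<le> 1 - phibar N w A' B'"
    if "A' \<union> B' \<subseteq> support h" "A' \<inter> B' = {}" "A' \<union> B' \<noteq> {}" for A' B'
    using AB(2)[of "(A', B')"] that by (simp add: P_def)
  have "2 * (1 - phibar N w A B) * l1norm h \<le> dual_variation h"
    by (intro dual_variation_ge_expansion minimal)
  then have "(1 - phibar N w A B) * (2 * l1norm h) \<le> dual_variation h" by (simp only: mult_ac)
  then have "1 - phibar N w A B \<le> dual_variation h / (2 * l1norm h)"
    using l1norm_pos[OF assms] by (intro mult_imp_le_div_pos) auto
  moreover have "A \<union> B \<subseteq> support h \<and> A \<inter> B = {} \<and> A \<union> B \<noteq> {}"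
    using AB(1) by (simp add: P_def)
  ultimately show ?thesis unfolding almost_bipartite_def by blast
qed

lemma sum_weights_mult_le:
  "(\<Sum>u<N. \<Sum>v<N. w u v * (\<bar>x u v\<bar> * \<bar>y u v\<bar>))
     \<le> sqrt (\<Sum>u<N. \<Sum>v<N. w u v * (x u v)\<^sup>2) * sqrt (\<Sum>u<N. \<Sum>v<N. w u v * (y u v)\<^sup>2)"
proof -
  let ?P = "{..<N} \<times> {..<N}"
  define weighted where "weighted z = (\<lambda>(u, v). sqrt (w u v) * z u v)" for z :: "nat \<Rightarrow> nat \<Rightarrow> real"
  have L2: "L2_set (weighted z) ?P = sqrt (\<Sum>u<N. \<Sum>v<N. w u v * (z u v)\<^sup>2)" for z
    unfolding L2_set_def sum.cartesian_product weighted_def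
    by (intro arg_cong[of _ _ sqrt] sum.cong refl) (auto simp: power_mult_distrib weight_nonneg)
  have "(\<Sum>u<N. \<Sum>v<N. w u v * (\<bar>x u v\<bar> * \<bar>y u v\<bar>)) = (\<Sum>p\<in>?P. \<bar>weighted x p\<bar> * \<bar>weighted y p\<bar>)"
    unfolding sum.cartesian_product weighted_def
  proof (intro sum.cong refl)
    fix p assume "p \<in> ?P"
    then obtain u v where p: "p = (u, v)" "0 \<le> w u v" using weight_nonneg by auto
    have "\<bar>r * a\<bar> * \<bar>r * b\<bar> = r * r * (\<bar>a\<bar> * \<bar>b\<bar>)" if "0 \<le> r" for r a b :: real
      using that by (simp add: abs_mult)
    from this[of "sqrt (w u v)" "x u v" "y u v"]
    show "(case p of (u, v) \<Rightarrow> w u v * (\<bar>x u v\<bar> * \<bar>y u v\<bar>))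
        = \<bar>case p of (u, v) \<Rightarrow> sqrt (w u v) * x u v\<bar> * \<bar>case p of (u, v) \<Rightarrow> sqrt (w u v) * y u v\<bar>"
      using p by simp
  qed
  then show ?thesis using L2_set_mult_ineq[of "weighted x" "weighted y" ?P] unfolding L2 by simp
qed

lemma dual_variation_zero_if_zero_energy:
  assumes "dual_energy f = 0"
  shows "dual_variation f = 0"
  using sum_weights_mult_le[of "\<lambda>u v. f u + f v" "\<lambda>_ _. 1"] assms dual_variation_nonneg[of f]
  unfolding dual_variation_def dual_energy_def by simp

lemma almost_bipartite_if_zero_energy:
  assumes "0 < sqnorm f" "dual_energy f = 0"
  shows "almost_bipartite (support f) 0"
  using signed_sweep[OF support_nonempty_if_sqnorm_pos[OF assms(1)]]
    dual_variation_zero_if_zero_energy[OF assms(2)] by simp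

lemma dual_variation_le:
  assumes "\<And>u v. \<bar>h u + h v\<bar> \<le> \<bar>f u + f v\<bar> * (\<bar>m u\<bar> + \<bar>f u + f v\<bar>)"
  shows "dual_variation h \<le> dual_energy f + sqrt (dual_energy f) * sqrt (sqnorm m)"
proof -
  have "dual_variation h \<le> (\<Sum>u<N. \<Sum>v<N. w u v * (\<bar>f u + f v\<bar> * \<bar>m u\<bar>) + w u v * (f u + f v)\<^sup>2)"
    unfolding dual_variation_def
  proof (intro sum_mono)
    fix u v assume "u \<in> {..<N}" "v \<in> {..<N}"
    then have "w u v * \<bar>h u + h v\<bar> \<le> w u v * (\<bar>f u + f v\<bar> * (\<bar>m u\<bar> + \<bar>f u + f v\<bar>))"
      using assms by (intro mult_left_mono weight_nonneg) auto
    then show "w u v * \<bar>h u + h v\<bar> \<le> w u v * (\<bar>f u + f v\<bar> * \<bar>m u\<bar>) + w u v * (f u + f v)\<^sup>2"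
      by (simp add: distrib_left power2_eq_square)
  qed
  also have "\<dots> = (\<Sum>u<N. \<Sum>v<N. w u v * (\<bar>f u + f v\<bar> * \<bar>m u\<bar>)) + dual_energy f"
    by (simp add: sum.distrib dual_energy_def)
  also have "(\<Sum>u<N. \<Sum>v<N. w u v * (\<bar>f u + f v\<bar> * \<bar>m u\<bar>)) \<le> sqrt (dual_energy f) * sqrt (sqnorm m)"
    using sum_weights_mult_le[of "\<lambda>u v. f u + f v" "\<lambda>u v. m u"]
    unfolding sum_weights_fst dual_energy_def sqnorm_def .
  finally show ?thesis by simp
qed

end

definition tent :: "real \<Rightarrow> real \<Rightarrow> real \<Rightarrow> real" where
  "tent a b x = max 0 (min (x - a) (b - x))"

definition covered :: "real \<Rightarrow> real \<Rightarrow> real \<Rightarrow> real" where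
  "covered a b x = max 0 (min x b - a)"

text \<open>Integrates the identity \<open>tent a b x = (x - a)\<^sub>+ - 2 (x - (a + b) / 2)\<^sub>+ + (x - b)\<^sub>+\<close>.\<close>
definition tent_primitive :: "real \<Rightarrow> real \<Rightarrow> real \<Rightarrow> real" where
  "tent_primitive a b x =
     ((max 0 (x - a))\<^sup>2 - 2 * (max 0 (x - (a + b) / 2))\<^sup>2 + (max 0 (x - b))\<^sup>2) / 2"

lemma tent_nonneg: "0 \<le> tent a b x"
  by (simp add: tent_def)

lemma tent_le_covered: "a \<le> b \<Longrightarrow> tent a b x \<le> covered a b x"
  by (auto simp: tent_def covered_def)

lemma tent_diff_le_covered_diff:
  "a \<le> b \<Longrightarrow> x \<le> y \<Longrightarrow> \<bar>tent a b x - tent a b y\<bar> \<le> covered a b y - covered a b x"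
  by (auto simp: tent_def covered_def max_def min_def)

lemma DERIV_truncated_square:
  fixes a x :: real
  shows "((\<lambda>x. (max 0 (x - a))\<^sup>2) has_real_derivative 2 * max 0 (x - a)) (at x)"
proof (cases x a rule: linorder_cases)
  case less
  have "((\<lambda>x. 0) has_real_derivative 0) (at x)" by simp
  then show ?thesis using less
    by (subst DERIV_cong_ev[OF refl _ refl, where g = "\<lambda>_. 0"])
      (auto simp: max_def eventually_nhds intro!: exI[of _ "{..<a}"])
next
  case greater
  have "((\<lambda>x. (x - a)\<^sup>2) has_real_derivative 2 * (x - a)) (at x)"
    by (auto intro!: derivative_eq_intros)
  then show ?thesis using greater
    by (subst DERIV_cong_ev[OF refl _ refl, where g = "\<lambda>x. (x - a)\<^sup>2"])
      (auto simp: max_def eventually_nhds intro!: exI[of _ "{a<..}"])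
next
  case equal
  have "(\<lambda>h. ((max 0 (a + h - a))\<^sup>2 - (max 0 (a - a))\<^sup>2) / h) \<midarrow>0\<rightarrow> 0"
  proof (rule tendsto_rabs_zero_cancel, rule tendsto_sandwich[of "\<lambda>_. 0" _ _ "\<lambda>h. \<bar>h\<bar>"])
    show "\<forall>\<^sub>F h in at 0. \<bar>((max 0 (a + h - a))\<^sup>2 - (max 0 (a - a))\<^sup>2) / h\<bar> \<le> \<bar>h\<bar>"
      by (intro always_eventually) (auto simp: max_def power2_eq_square)
    show "((\<lambda>h. \<bar>h\<bar>) \<longlongrightarrow> 0) (at (0::real))" by (intro tendsto_rabs_zero tendsto_ident_at)
  qed auto
  then show ?thesis unfolding equal DERIV_def by simp
qed

lemma DERIV_tent_primitive:
  assumes "a \<le> b"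
  shows "(tent_primitive a b has_real_derivative tent a b x) (at x)"
proof -
  have "(tent_primitive a b has_real_derivative
      (2 * max 0 (x - a) - 2 * (2 * max 0 (x - (a + b) / 2)) + 2 * max 0 (x - b)) / 2) (at x)"
    unfolding tent_primitive_def
    by (intro DERIV_cdivide DERIV_add DERIV_diff DERIV_cmult DERIV_truncated_square)
  also have "(2 * max 0 (x - a) - 2 * (2 * max 0 (x - (a + b) / 2)) + 2 * max 0 (x - b)) / 2
      = tent a b x"
    using assms by (auto simp: tent_def max_def min_def field_simps)
  finally show ?thesis .
qed

lemma covered_square_le_tent_primitive:
  assumes "a \<le> b"
  shows "(covered a b x)\<^sup>2 \<le> 4 * tent_primitive a b x"
proof -
  consider (left) "x \<le> a" | (rising) "a < x" "x \<le> (a + b) / 2"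
    | (falling) "(a + b) / 2 < x" "x \<le> b" | (right) "a < x" "b < x"
    using assms by linarith
  then show ?thesis
  proof cases
    case left
    then show ?thesis using assms by (simp add: tent_primitive_def covered_def)
  next
    case rising
    then show ?thesis using assms by (simp add: tent_primitive_def covered_def)
  next
    case falling
    then have "0 \<le> 2 * (x - (a + b) / 2)" "2 * (x - (a + b) / 2) \<le> x - a"
      by (simp_all add: field_simps)
    then have "(2 * (x - (a + b) / 2))\<^sup>2 \<le> (x - a)\<^sup>2" by (intro power_mono)
    then have "4 * (x - (a + b) / 2)\<^sup>2 \<le> (x - a)\<^sup>2" unfolding power_mult_distrib by simp
    moreover have "covered a b x = x - a" "max 0 (x - a) = x - a" "max 0 (x - b) = 0"
      "max 0 (x - (a + b) / 2) = x - (a + b) / 2" using falling assms by (auto simp: covered_def)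
    ultimately show ?thesis unfolding tent_primitive_def by simp
  next
    case right
    then have explicit: "covered a b x = b - a" "max 0 (x - a) = x - a" "max 0 (x - b) = x - b"
      "max 0 (x - (a + b) / 2) = x - (a + b) / 2" using assms by (auto simp: covered_def)
    show ?thesis unfolding tent_primitive_def explicit by (simp add: power2_eq_square field_simps)
  qed
qed

locale thresholds =
  fixes t :: "nat \<Rightarrow> real"
  assumes incseq: "incseq t" and start: "t 0 = 0"
begin

abbreviation step_tent :: "nat \<Rightarrow> real \<Rightarrow> real" where
  "step_tent i \<equiv> tent (t i) (t (Suc i))"

abbreviation step_covered :: "nat \<Rightarrow> real \<Rightarrow> real" where
  "step_covered i \<equiv> covered (t i) (t (Suc i))"

definition threshold_dist :: "nat \<Rightarrow> real \<Rightarrow> real" where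
  "threshold_dist m x = (\<Sum>i<m. step_tent i x)"

definition threshold_primitive :: "nat \<Rightarrow> real \<Rightarrow> real" where
  "threshold_primitive m x = (\<Sum>i<m. tent_primitive (t i) (t (Suc i)) x)"

lemma threshold_le_Suc: "t i \<le> t (Suc i)"
  using incseq by (rule incseq_SucD)

lemma threshold_nonneg: "0 \<le> t i"
  using incseqD[OF incseq, of 0 i] start by simp

lemma step_tent_zero: "step_tent i 0 = 0"
  using threshold_nonneg[of i] by (auto simp: tent_def max_def min_def)

lemma step_tent_disjoint:
  assumes "i \<noteq> j"
  shows "step_tent i x = 0 \<or> step_tent j x = 0"
proof -
  have "step_tent i x = 0 \<or> step_tent j x = 0" if "i < j" for i j
    using incseqD[OF incseq, of "Suc i" j] that by (auto simp: tent_def max_def min_def)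
  then show ?thesis using assms by (metis linorder_neqE_nat)
qed

lemma sum_step_covered: "0 \<le> x \<Longrightarrow> (\<Sum>i<m. step_covered i x) = min x (t m)"
proof (induction m)
  case 0
  then show ?case by (simp add: start)
next
  case (Suc m)
  then show ?case using threshold_le_Suc[of m] by (auto simp: covered_def max_def min_def)
qed

lemma threshold_dist_nonneg: "0 \<le> threshold_dist m x"
  unfolding threshold_dist_def by (intro sum_nonneg tent_nonneg)

lemma threshold_dist_le: "0 \<le> x \<Longrightarrow> threshold_dist m x \<le> x"
  using sum_mono[of "{..<m}" "\<lambda>i. step_tent i x" "\<lambda>i. step_covered i x"]
    tent_le_covered[OF threshold_le_Suc] sum_step_covered[of x m] by (simp add: threshold_dist_def)

lemma sum_step_tent_diff_le:
  assumes "0 \<le> x" "0 \<le> y"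
  shows "(\<Sum>i<m. \<bar>step_tent i x - step_tent i y\<bar>) \<le> \<bar>x - y\<bar>"
  using assms
proof (induction x y rule: linorder_wlog)
  case (le x y)
  have "(\<Sum>i<m. \<bar>step_tent i x - step_tent i y\<bar>) \<le> (\<Sum>i<m. step_covered i y - step_covered i x)"
    using le threshold_le_Suc by (intro sum_mono tent_diff_le_covered_diff)
  also have "\<dots> = min y (t m) - min x (t m)" using le by (simp add: sum_subtractf sum_step_covered)
  finally show ?case using le by simp
next
  case (sym x y)
  then show ?case by (simp add: abs_minus_commute)
qed

lemma threshold_dist_lipschitz:
  assumes "0 \<le> x" "0 \<le> y"
  shows "threshold_dist m x \<le> threshold_dist m y + \<bar>x - y\<bar>"
proof -
  have "threshold_dist m x - threshold_dist m y \<le> (\<Sum>i<m. \<bar>step_tent i x - step_tent i y\<bar>)"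
    unfolding threshold_dist_def sum_subtractf[symmetric] by (intro sum_mono) simp
  then show ?thesis using sum_step_tent_diff_le[OF assms, of m] by simp
qed

lemma sum_signed_step_tent_le:
  "(\<Sum>i<m. \<bar>sgn x * step_tent i \<bar>x\<bar> + sgn y * step_tent i \<bar>y\<bar>\<bar>) \<le> \<bar>x + y\<bar>"
proof (cases "0 \<le> x * y")
  case True
  have "(\<Sum>i<m. \<bar>sgn x * step_tent i \<bar>x\<bar> + sgn y * step_tent i \<bar>y\<bar>\<bar>)
      \<le> (\<Sum>i<m. step_tent i \<bar>x\<bar> + step_tent i \<bar>y\<bar>)"
    by (intro sum_mono order_trans[OF abs_triangle_ineq] add_mono)
      (auto simp: abs_mult abs_sgn_eq tent_nonneg)
  also have "\<dots> \<le> \<bar>x\<bar> + \<bar>y\<bar>"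
    using threshold_dist_le[of "\<bar>x\<bar>" m] threshold_dist_le[of "\<bar>y\<bar>" m]
    by (simp add: sum.distrib threshold_dist_def)
  also have "\<dots> = \<bar>x + y\<bar>" using True by (auto simp: zero_le_mult_iff)
  finally show ?thesis .
next
  case False
  then have opposite: "(0 < x \<and> y < 0) \<or> (x < 0 \<and> 0 < y)" by (auto simp: not_le mult_less_0_iff)
  then have "\<bar>sgn x * r + sgn y * s\<bar> = \<bar>r - s\<bar>" for r s by auto
  then have "(\<Sum>i<m. \<bar>sgn x * step_tent i \<bar>x\<bar> + sgn y * step_tent i \<bar>y\<bar>\<bar>) \<le> \<bar>\<bar>x\<bar> - \<bar>y\<bar>\<bar>"
    using sum_step_tent_diff_le[of "\<bar>x\<bar>" "\<bar>y\<bar>" m] by simp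
  also have "\<dots> = \<bar>x + y\<bar>" using opposite by auto
  finally show ?thesis .
qed

lemma square_le_threshold_primitive:
  assumes "0 \<le> x" "x \<le> t m"
  shows "x\<^sup>2 \<le> 4 * real m * threshold_primitive m x"
proof -
  have "x\<^sup>2 = (\<Sum>i<m. step_covered i x)\<^sup>2" using assms by (simp add: sum_step_covered)
  \<comment> \<open>Cauchy-Schwarz over the intervals between the thresholds\<close>
  also have "\<dots> \<le> (\<Sum>i<m. (step_covered i x)\<^sup>2) * card {..<m}" by (rule sum_squared_le_sum_of_squares)
  also have "\<dots> \<le> (\<Sum>i<m. 4 * tent_primitive (t i) (t (Suc i)) x) * card {..<m}"
    using threshold_le_Suc by (intro mult_right_mono sum_mono covered_square_le_tent_primitive) auto
  finally show ?thesis by (simp add: threshold_primitive_def mult_ac flip: sum_distrib_left)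
qed

lemma threshold_primitive_zero: "threshold_primitive m 0 = 0"
  using threshold_nonneg by (simp add: threshold_primitive_def tent_primitive_def)

lemma threshold_primitive_diff_le:
  assumes "0 \<le> x" "x \<le> y" "0 \<le> z" "\<bar>x - z\<bar> \<le> r" "\<bar>y - z\<bar> \<le> r"
  shows "\<bar>threshold_primitive m y - threshold_primitive m x\<bar> \<le> (y - x) * (threshold_dist m z + r)"
proof (cases "x = y")
  case False
  have "(threshold_primitive m has_real_derivative threshold_dist m x) (at x)" for x
    unfolding threshold_primitive_def threshold_dist_def
    using threshold_le_Suc by (intro DERIV_sum DERIV_tent_primitive)
  then obtain c where c: "x < c" "c < y"
    "threshold_primitive m y - threshold_primitive m x = (y - x) * threshold_dist m c"
    using MVT2[of x y "threshold_primitive m" "threshold_dist m"] False assms(2) by auto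
  have "threshold_dist m c \<le> threshold_dist m z + r"
    using threshold_dist_lipschitz[of c z m] c(1,2) assms by linarith
  then show ?thesis unfolding c(3)
    using assms(2) threshold_dist_nonneg[of m c] by (simp add: abs_mult mult_left_mono)
qed (use assms threshold_dist_nonneg in simp)

lemma signed_threshold_primitive_add_le:
  fixes x y :: real and m :: nat
  defines "H \<equiv> threshold_primitive m"
  shows "\<bar>sgn x * H \<bar>x\<bar> + sgn y * H \<bar>y\<bar>\<bar> \<le> \<bar>x + y\<bar> * (threshold_dist m \<bar>x\<bar> + \<bar>x + y\<bar>)"
proof (cases "0 \<le> x * y")
  case True
  then have add: "\<bar>x + y\<bar> = \<bar>x\<bar> + \<bar>y\<bar>" by (auto simp: zero_le_mult_iff)
  have H_le: "\<bar>H z\<bar> \<le> z * (threshold_dist m \<bar>x\<bar> + \<bar>x + y\<bar>)" if "z = \<bar>x\<bar> \<or> z = \<bar>y\<bar>" for z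
    using threshold_primitive_diff_le[of 0 z "\<bar>x\<bar>" "\<bar>x + y\<bar>" m] that
    unfolding H_def threshold_primitive_zero add by auto
  have "\<bar>sgn x * H \<bar>x\<bar> + sgn y * H \<bar>y\<bar>\<bar> \<le> \<bar>H \<bar>x\<bar>\<bar> + \<bar>H \<bar>y\<bar>\<bar>"
    by (intro order_trans[OF abs_triangle_ineq] add_mono) (auto simp: abs_mult abs_sgn_eq)
  then show ?thesis using H_le[of "\<bar>x\<bar>"] H_le[of "\<bar>y\<bar>"] unfolding add by (simp add: distrib_right)
next
  case False
  then have opposite: "(0 < x \<and> y < 0) \<or> (x < 0 \<and> 0 < y)" by (auto simp: not_le mult_less_0_iff)
  then have sub: "\<bar>x + y\<bar> = \<bar>\<bar>x\<bar> - \<bar>y\<bar>\<bar>" and "\<bar>sgn x * H \<bar>x\<bar> + sgn y * H \<bar>y\<bar>\<bar> = \<bar>H \<bar>x\<bar> - H \<bar>y\<bar>\<bar>"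
    by auto
  moreover have "\<bar>H \<bar>x\<bar> - H \<bar>y\<bar>\<bar> \<le> \<bar>\<bar>x\<bar> - \<bar>y\<bar>\<bar> * (threshold_dist m \<bar>x\<bar> + \<bar>\<bar>x\<bar> - \<bar>y\<bar>\<bar>)"
  proof (cases "\<bar>x\<bar> \<le> \<bar>y\<bar>")
    case True
    then show ?thesis
      using threshold_primitive_diff_le[of "\<bar>x\<bar>" "\<bar>y\<bar>" "\<bar>x\<bar>" "\<bar>y\<bar> - \<bar>x\<bar>" m]
      by (simp add: H_def abs_minus_commute)
  next
    case False
    then show ?thesis
      using threshold_primitive_diff_le[of "\<bar>y\<bar>" "\<bar>x\<bar>" "\<bar>x\<bar>" "\<bar>x\<bar> - \<bar>y\<bar>" m] by (simp add: H_def)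
  qed
  ultimately show ?thesis by simp
qed

end

lemma equidistributed_thresholds:
  fixes \<Phi> :: "real \<Rightarrow> real \<Rightarrow> real"
  assumes "0 \<le> M" and cont: "\<And>a. continuous_on {a..M} (\<Phi> a)" and diag: "\<And>a. \<Phi> a a \<le> c"
  obtains t where "incseq t" "t 0 = 0" "\<And>i. t i \<le> M" "\<And>i. \<Phi> (t i) (t (Suc i)) \<le> c"
    "\<And>i. t (Suc i) < M \<Longrightarrow> \<Phi> (t i) (t (Suc i)) = c"
proof -
  have next_threshold: "\<exists>b. a \<le> b \<and> b \<le> M \<and> \<Phi> a b \<le> c \<and> (b < M \<longrightarrow> \<Phi> a b = c)"
    if a: "a \<le> M" for a
  proof (cases "\<Phi> a M \<le> c")
    case True
    then show ?thesis using a by (intro exI[of _ M]) auto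
  next
    case False
    then obtain b where "a \<le> b" "b \<le> M" "\<Phi> a b = c"
      using IVT'[of "\<Phi> a" a c M] cont diag a by auto
    then show ?thesis by auto
  qed
  have "\<exists>t. \<forall>i. (t i \<le> M \<and> (i = 0 \<longrightarrow> t i = 0)) \<and>
     (t i \<le> t (Suc i) \<and> \<Phi> (t i) (t (Suc i)) \<le> c \<and> (t (Suc i) < M \<longrightarrow> \<Phi> (t i) (t (Suc i)) = c))"
  proof (rule dependent_nat_choice)
    show "\<exists>x. x \<le> M \<and> ((0::nat) = 0 \<longrightarrow> x = 0)" using assms(1) by auto
  next
    fix a :: real and i :: nat
    assume "a \<le> M \<and> (i = 0 \<longrightarrow> a = 0)"
    then show "\<exists>b. (b \<le> M \<and> (Suc i = 0 \<longrightarrow> b = 0)) \<and>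
        (a \<le> b \<and> \<Phi> a b \<le> c \<and> (b < M \<longrightarrow> \<Phi> a b = c))"
      using next_threshold[of a] by auto
  qed
  then show ?thesis using that by (metis incseq_SucI)
qed

lemma many_small_summands:
  fixes e :: "nat \<Rightarrow> real"
  assumes e: "\<And>i. 0 \<le> e i" "(\<Sum>i<2 * l. e i) \<le> E" and "0 < E" "0 < l"
  obtains \<sigma> where "inj_on \<sigma> {..<l}" "\<sigma> ` {..<l} \<subseteq> {..<2 * l}" "\<And>i. i < l \<Longrightarrow> e (\<sigma> i) \<le> E / real l"
proof -
  define large where "large = {i\<in>{..<2 * l}. E / real l < e i}"
  have "real (card large) * (E / real l) \<le> (\<Sum>i\<in>large. e i)"
    by (intro sum_bounded_below) (auto simp: large_def)
  also have "\<dots> \<le> (\<Sum>i<2 * l. e i)" using e(1) by (intro sum_mono2) (auto simp: large_def)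
  also have "\<dots> \<le> real l * (E / real l)" using e(2) assms(4) by simp
  finally have "real (card large) * E \<le> real l * E" using assms(3,4) by (simp add: field_simps)
  then have "card large \<le> l" using assms(3) by simp
  then have "l \<le> card ({..<2 * l} - large)" by (subst card_Diff_subset) (auto simp: large_def)
  then obtain small where small: "small \<subseteq> {..<2 * l} - large" "card small = l" "finite small"
    using obtain_subset_with_card_n by blast
  then obtain \<sigma> where "bij_betw \<sigma> {..<l} small"
    using ex_bij_betw_nat_finite by (metis atLeast0LessThan)
  then have \<sigma>: "inj_on \<sigma> {..<l}" "\<sigma> ` {..<l} = small" by (auto simp: bij_betw_def)
  then have "\<sigma> i \<in> {..<2 * l} - large" if "i < l" for i using small(1) that by blast
  then show ?thesis using \<sigma> small(1) by (intro that[of \<sigma>]) (auto simp: large_def not_less)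
qed

locale thresholded_function = weighted_graph N w + thresholds t
  for N :: nat and w :: "nat \<Rightarrow> nat \<Rightarrow> real" and t :: "nat \<Rightarrow> real" +
  fixes f :: "nat \<Rightarrow> real"
begin

definition truncation :: "nat \<Rightarrow> nat \<Rightarrow> real" where
  "truncation i u = sgn (f u) * step_tent i \<bar>f u\<bar>"

lemma sqnorm_truncation: "sqnorm (truncation i) = (\<Sum>u<N. deg N w u * (step_tent i \<bar>f u\<bar>)\<^sup>2)"
  unfolding sqnorm_def truncation_def
  by (intro sum.cong refl) (auto simp: sgn_real_def step_tent_zero)

lemma disjoint_supports_truncation: "disjoint_family (\<lambda>i. support (truncation i))"
  using step_tent_disjoint by (fastforce simp: disjoint_family_on_def support_def truncation_def)

lemma sum_dual_energy_truncation_le: "(\<Sum>i<m. dual_energy (truncation i)) \<le> dual_energy f"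
  unfolding sum_dual_energy dual_energy_def[of f]
proof (intro sum_mono mult_left_mono)
  fix u v assume "u \<in> {..<N}" "v \<in> {..<N}"
  then show "0 \<le> w u v" by (simp add: weight_nonneg)
  have "L2_set (\<lambda>i. truncation i u + truncation i v) {..<m} \<le> \<bar>f u + f v\<bar>"
    using sum_signed_step_tent_le[of "f u" "f v" m] unfolding truncation_def
    by (rule order_trans[OF L2_set_le_sum_abs])
  then have "(L2_set (\<lambda>i. truncation i u + truncation i v) {..<m})\<^sup>2 \<le> \<bar>f u + f v\<bar>\<^sup>2"
    by (intro power_mono) auto
  then show "(\<Sum>i<m. (truncation i u + truncation i v)\<^sup>2) \<le> (f u + f v)\<^sup>2"
    by (simp add: L2_set_def sum_nonneg)
qed

lemma sqnorm_threshold_dist: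
  "sqnorm (\<lambda>u. threshold_dist m \<bar>f u\<bar>) = (\<Sum>i<m. sqnorm (truncation i))"
proof -
  have "(threshold_dist m x)\<^sup>2 = (\<Sum>i<m. (step_tent i x)\<^sup>2)" for x
    unfolding threshold_dist_def using step_tent_disjoint
    by (intro square_sum_pairwise_orthogonal) (auto simp: pairwise_def)
  then have "sqnorm (\<lambda>u. threshold_dist m \<bar>f u\<bar>) = (\<Sum>u<N. \<Sum>i<m. deg N w u * (step_tent i \<bar>f u\<bar>)\<^sup>2)"
    by (simp add: sqnorm_def sum_distrib_left)
  then show ?thesis unfolding sqnorm_truncation by (subst sum.swap)
qed

lemma exists_small_truncation:
  assumes l_range: "1 \<le> l" "l \<le> N" and gap: "0 < dual_gap l" and energy: "0 < dual_energy f"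
  shows "\<exists>i<2 * l. sqnorm (truncation i) < 2 * dual_energy f / (real l * dual_gap l)"
proof (rule ccontr)
  assume "\<not> ?thesis"
  then have large: "2 * dual_energy f / (real l * dual_gap l) \<le> sqnorm (truncation i)"
    if "i < 2 * l" for i
    using that by (meson not_less)
  obtain \<sigma> where \<sigma>: "inj_on \<sigma> {..<l}" "\<sigma> ` {..<l} \<subseteq> {..<2 * l}"
    and small: "\<And>i. i < l \<Longrightarrow> dual_energy (truncation (\<sigma> i)) \<le> dual_energy f / real l"
    using many_small_summands[of "\<lambda>i. dual_energy (truncation i)" l "dual_energy f"]
      dual_energy_nonneg sum_dual_energy_truncation_le energy l_range(1) by auto
  have "dual_gap l \<le> dual_gap l / 2"
  proof (rule dual_gap_le_disjoint_supports[OF l_range])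
    show "disjoint_family_on (\<lambda>i. support (truncation (\<sigma> i))) {..<l}"
      using disjoint_supports_truncation \<sigma>(1) by (auto simp: disjoint_family_on_def inj_on_def)
    fix i assume i: "i < l"
    then have lower: "2 * dual_energy f / (real l * dual_gap l) \<le> sqnorm (truncation (\<sigma> i))"
      using \<sigma>(2) by (intro large) auto
    moreover have "0 < 2 * dual_energy f / (real l * dual_gap l)"
      using energy gap l_range(1) by simp
    ultimately have "0 < sqnorm (truncation (\<sigma> i))" by linarith
    moreover have "dual_energy (truncation (\<sigma> i)) \<le> dual_gap l / 2 * sqnorm (truncation (\<sigma> i))"
    proof -
      have "dual_energy (truncation (\<sigma> i)) \<le> dual_energy f / real l" using i by (rule small)
      also have "\<dots> = dual_gap l / 2 * (2 * dual_energy f / (real l * dual_gap l))" using gap by simp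
      also have "\<dots> \<le> dual_gap l / 2 * sqnorm (truncation (\<sigma> i))"
        using lower gap by (intro mult_left_mono) auto
      finally show ?thesis .
    qed
    ultimately show "rayleigh_le (truncation (\<sigma> i)) (dual_gap l / 2)" by (simp add: rayleigh_le_def)
  qed
  then show False using gap by simp
qed

text \<open>Sweeping the composition of \<open>f\<close> with the odd extension of \<open>threshold_primitive\<close>.\<close>
lemma almost_bipartite_threshold_sweep:
  assumes range: "\<And>u. u < N \<Longrightarrow> \<bar>f u\<bar> \<le> t m" and f: "0 < sqnorm f"
  defines "E \<equiv> dual_energy f"
  shows "almost_bipartite (support f)
    (2 * real m * (E + sqrt E * sqrt (\<Sum>i<m. sqnorm (truncation i))) / sqnorm f)"
proof -
  define h where "h u = sgn (f u) * threshold_primitive m \<bar>f u\<bar>" for u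
  have square_le: "(f u)\<^sup>2 \<le> 4 * real m * \<bar>h u\<bar>" if "u < N" for u
  proof (cases "f u = 0")
    case False
    have "(f u)\<^sup>2 \<le> 4 * real m * threshold_primitive m \<bar>f u\<bar>"
      using square_le_threshold_primitive[of "\<bar>f u\<bar>" m] range[OF that] by simp
    also have "\<dots> \<le> 4 * real m * \<bar>h u\<bar>"
      using False by (intro mult_left_mono) (auto simp: h_def abs_mult abs_sgn_eq)
    finally show ?thesis .
  qed simp
  have support_h: "support h = support f"
    using square_le by (force simp: support_def h_def sgn_zero_iff)
  have "sqnorm f \<le> (\<Sum>u<N. deg N w u * (4 * real m * \<bar>h u\<bar>))"
    unfolding sqnorm_def using square_le by (intro sum_mono mult_left_mono) (auto simp: deg_nonneg)
  then have norm: "sqnorm f \<le> 4 * real m * l1norm h"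
    by (simp add: l1norm_def sum_distrib_left mult_ac)
  have "dual_variation h \<le> E + sqrt E * sqrt (sqnorm (\<lambda>u. threshold_dist m \<bar>f u\<bar>))"
    unfolding E_def h_def using signed_threshold_primitive_add_le threshold_dist_nonneg
    by (intro dual_variation_le) auto
  then have variation: "dual_variation h \<le> E + sqrt E * sqrt (\<Sum>i<m. sqnorm (truncation i))"
    unfolding sqnorm_threshold_dist .
  have nonempty: "support h \<noteq> {}"
    unfolding support_h using f by (rule support_nonempty_if_sqnorm_pos)
  have "0 < 4 * real m * l1norm h" using norm f by linarith
  then have "dual_variation h / (2 * l1norm h)
      = 2 * real m * dual_variation h / (4 * real m * l1norm h)"
    by auto
  also have "\<dots> \<le> 2 * real m * (E + sqrt E * sqrt (\<Sum>i<m. sqnorm (truncation i))) / sqnorm f"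
    using variation norm f dual_variation_nonneg[of h] by (intro frac_le mult_left_mono) auto
  finally show ?thesis
    using signed_sweep[OF nonempty] unfolding support_h by (rule almost_bipartite_mono[rotated])
qed

end

lemma add_sqrt_mult_sqrt_le:
  fixes E g T :: real
  assumes "0 < E" "0 < g" "g \<le> 2" "T \<le> 4 * E / g"
  shows "E + sqrt E * sqrt T \<le> 4 * (E / sqrt g)"
proof -
  have "sqrt E * sqrt T \<le> sqrt E * sqrt (4 * E / g)" using assms by (intro mult_left_mono) auto
  also have "\<dots> = 2 * (E / sqrt g)" using assms(1) by (simp add: real_sqrt_divide real_sqrt_mult)
  finally have "sqrt E * sqrt T \<le> 2 * (E / sqrt g)" .
  moreover have "E \<le> 2 * (E / sqrt g)"
  proof -
    have "sqrt g \<le> 2" using assms(3) by (intro real_le_lsqrt) auto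
    then show ?thesis using assms(1,2) by (simp add: pos_le_divide_eq)
  qed
  ultimately show ?thesis by linarith
qed

context weighted_graph
begin

lemma exhausting_thresholds:
  assumes l_range: "1 \<le> l" "l \<le> N" and gap: "0 < dual_gap l" and energy: "0 < dual_energy f"
  obtains t where "thresholded_function N w t" "\<And>u. u < N \<Longrightarrow> \<bar>f u\<bar> \<le> t (2 * l)"
    "\<And>i. sqnorm (thresholded_function.truncation t f i) \<le> 2 * dual_energy f / (real l * dual_gap l)"
proof -
  let ?c = "2 * dual_energy f / (real l * dual_gap l)"
  define \<Phi> where "\<Phi> a b = (\<Sum>u<N. deg N w u * (tent a b \<bar>f u\<bar>)\<^sup>2)" for a b
  define M where "M = Max ((\<lambda>u. \<bar>f u\<bar>) ` {..<N})"
  have M: "\<bar>f u\<bar> \<le> M" if "u < N" for u unfolding M_def using that by (intro Max_ge) auto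
  have "0 < N" using l_range by simp
  then have "0 \<le> M" using M[of 0] by simp
  moreover have "continuous_on {a..M} (\<Phi> a)" for a
    unfolding \<Phi>_def tent_def by (intro continuous_intros)
  moreover have "\<Phi> a a \<le> ?c" for a
  proof -
    have "tent a a x = 0" for x by (auto simp: tent_def max_def min_def)
    then show ?thesis using energy gap by (simp add: \<Phi>_def)
  qed
  ultimately obtain t where t: "incseq t" "t 0 = 0" "\<And>i. t i \<le> M" "\<And>i. \<Phi> (t i) (t (Suc i)) \<le> ?c"
    "\<And>i. t (Suc i) < M \<Longrightarrow> \<Phi> (t i) (t (Suc i)) = ?c"
    by (rule equidistributed_thresholds) blast
  interpret thresholded_function N w t f using t(1,2) by unfold_locales
  have norm: "sqnorm (truncation i) = \<Phi> (t i) (t (Suc i))" for i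
    unfolding sqnorm_truncation \<Phi>_def ..
  have "t (2 * l) = M"
  proof (rule ccontr)
    assume "t (2 * l) \<noteq> M"
    then have "t (Suc i) < M" if "i < 2 * l" for i
      using incseqD[OF t(1), of "Suc i" "2 * l"] t(3)[of "2 * l"] that by simp
    then show False using exists_small_truncation[OF l_range gap energy] t(5) by (auto simp: norm)
  qed
  then show ?thesis using M t(4) thresholded_function_axioms
    by (intro that[of t]) (simp_all add: norm)
qed

lemma improved_dual_cheeger:
  assumes l_range: "1 \<le> l" "l \<le> N" and gap: "0 < dual_gap l" and f: "0 < sqnorm f"
  shows "almost_bipartite (support f)
    (16 * real l * (dual_energy f / sqnorm f) / sqrt (dual_gap l))"
proof (cases "dual_energy f = 0")
  case True
  then show ?thesis using almost_bipartite_if_zero_energy[OF f] by simp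
next
  case False
  define E where "E = dual_energy f"
  define g where "g = dual_gap l"
  have E: "0 < E" using False dual_energy_nonneg[of f] by (simp add: E_def)
  have g: "0 < g" "g \<le> 2" using gap dual_gap_bounds(2)[OF l_range] by (auto simp: g_def)
  obtain t where t: "thresholded_function N w t" "\<And>u. u < N \<Longrightarrow> \<bar>f u\<bar> \<le> t (2 * l)"
    "\<And>i. sqnorm (thresholded_function.truncation t f i) \<le> 2 * E / (real l * g)"
    using exhausting_thresholds[OF l_range gap] E unfolding E_def g_def by blast
  interpret thresholded_function N w t f by (rule t(1))
  let ?T = "\<Sum>i<2 * l. sqnorm (truncation i)"
  have "?T \<le> real (card {..<2 * l}) * (2 * E / (real l * g))"
    using t(3) by (intro sum_bounded_above) auto
  then have "?T \<le> 4 * E / g" using l_range(1) by simp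
  then have sum_le: "E + sqrt E * sqrt ?T \<le> 4 * (E / sqrt g)"
    using E g by (intro add_sqrt_mult_sqrt_le)
  have "2 * real (2 * l) * (E + sqrt E * sqrt ?T) / sqnorm f
      \<le> 2 * real (2 * l) * (4 * (E / sqrt g)) / sqnorm f"
    using sum_le f by (intro divide_right_mono mult_left_mono) auto
  also have "\<dots> = 16 * real l * (E / sqnorm f) / sqrt g" by (simp add: mult_ac)
  finally show ?thesis
    using almost_bipartite_threshold_sweep[OF t(2) f] unfolding E_def g_def
    by (rule almost_bipartite_mono[rotated])
qed

end

section \<open>Region growing in pseudometric spaces\<close>

lemma exists_subset_sum_between:
  fixes m :: "'a \<Rightarrow> real"
  assumes "finite S" "\<And>s. s \<in> S \<Longrightarrow> 0 \<le> m s \<and> m s \<le> b" "0 \<le> b" "2 * a \<le> b" "a \<le> sum m S"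
  shows "\<exists>T\<subseteq>S. a \<le> sum m T \<and> sum m T \<le> b"
  using assms
proof (induction S rule: finite_induct)
  case (insert s S)
  consider (rest) "a \<le> sum m S" | (single) "a \<le> m s" | (all) "sum m S < a" "m s < a" by linarith
  then show ?case
  proof cases
    case rest
    then show ?thesis using insert by (meson insertCI subset_insertI2)
  next
    case single
    then show ?thesis using insert.prems by (intro exI[of _ "{s}"]) auto
  next
    case all
    then have "sum m (insert s S) \<le> b" using insert by simp
    then show ?thesis using insert.prems(4) by blast
  qed
qed auto

lemma disjoint_groups_of_large_sum:
  fixes m :: "'a \<Rightarrow> real"
  assumes "finite S" "\<And>s. s \<in> S \<Longrightarrow> 0 \<le> m s \<and> m s \<le> b" "0 \<le> b" "2 * a \<le> b"
    and "(real k - 1) * b + a \<le> sum m S"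
  shows "\<exists>G. (\<forall>i<k. G i \<subseteq> S \<and> a \<le> sum m (G i)) \<and> disjoint_family_on G {..<k}"
  using assms
proof (induction k arbitrary: S)
  case 0
  then show ?case by (simp add: disjoint_family_on_def)
next
  case (Suc k)
  have "a \<le> (real (Suc k) - 1) * b + a" using Suc.prems(3) by simp
  also note Suc.prems(5)
  finally obtain T where T: "T \<subseteq> S" "a \<le> sum m T" "sum m T \<le> b"
    using exists_subset_sum_between[of S m b a] Suc.prems by auto
  have "sum m S = sum m (S - T) + sum m T" using T(1) Suc.prems(1) by (rule sum.subset_diff)
  then have "(real k - 1) * b + a \<le> sum m (S - T)"
    using Suc.prems(5) T(3) by (simp add: left_diff_distrib)
  then obtain G where G: "\<forall>i<k. G i \<subseteq> S - T \<and> a \<le> sum m (G i)" "disjoint_family_on G {..<k}"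
    using Suc.IH[of "S - T"] Suc.prems(1-4) by auto
  have "\<forall>i<Suc k. (G(k := T)) i \<subseteq> S \<and> a \<le> sum m ((G(k := T)) i)"
    using G(1) T by (auto simp: less_Suc_eq)
  moreover have "disjoint_family_on (G(k := T)) {..<Suc k}"
    using G by (fastforce simp: disjoint_family_on_def less_Suc_eq)
  ultimately show ?case by blast
qed

lemma exists_slow_growth_step:
  fixes a :: "nat \<Rightarrow> real"
  assumes "0 < J" "0 \<le> q" "a J \<le> q ^ J * a 0"
  shows "\<exists>j<J. a (Suc j) \<le> q * a j"
proof (rule ccontr)
  assume "\<not> ?thesis"
  then have grow: "q * a j < a (Suc j)" if "j < J" for j using that by (meson not_le)
  have power_le: "q ^ j * a 0 \<le> a j" if "j \<le> J" for j
    using that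
  proof (induction j)
    case (Suc j)
    have "q * (q ^ j * a 0) \<le> q * a j" using Suc assms(2) by (intro mult_left_mono) auto
    then show ?case using grow[of j] Suc.prems by simp
  qed simp
  obtain j where j: "J = Suc j" using assms(1) by (cases J) auto
  have "q * (q ^ j * a 0) \<le> q * a j" using power_le[of j] j assms(2) by (intro mult_left_mono) auto
  then show False using grow[of j] assms(3) j by simp
qed

locale pseudo_metric =
  fixes \<rho> :: "'a \<Rightarrow> 'a \<Rightarrow> real"
  assumes dist_refl: "\<rho> u u = 0" and dist_commute: "\<rho> u v = \<rho> v u"
    and dist_triangle: "\<rho> u w \<le> \<rho> u v + \<rho> v w"
begin

definition ball_in :: "'a set \<Rightarrow> 'a \<Rightarrow> real \<Rightarrow> 'a set" where
  "ball_in V c r = {u\<in>V. \<rho> c u \<le> r}"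

definition far_apart :: "real \<Rightarrow> 'a set \<Rightarrow> 'a set \<Rightarrow> bool" where
  "far_apart \<delta> S T \<longleftrightarrow> (\<forall>u\<in>S. \<forall>v\<in>T. \<delta> < \<rho> u v)"

definition ball_doubling :: "('a \<Rightarrow> real) \<Rightarrow> real \<Rightarrow> real \<Rightarrow> 'a set \<Rightarrow> bool" where
  "ball_doubling m K r V \<longleftrightarrow>
     (\<forall>R\<subseteq>V. \<forall>c\<in>R. \<exists>p\<in>R. sum m (ball_in R c r) \<le> K * sum m (ball_in R p (r / 2)))"

lemma dist_nonneg: "0 \<le> \<rho> u v"
  using dist_triangle[of u u v] by (simp add: dist_refl dist_commute[of v u])

lemma far_apart_commute: "far_apart \<delta> S T \<Longrightarrow> far_apart \<delta> T S"
  unfolding far_apart_def by (metis dist_commute)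

lemma far_apart_mono: "far_apart \<delta> S T \<Longrightarrow> S' \<subseteq> S \<Longrightarrow> T' \<subseteq> T \<Longrightarrow> far_apart \<delta> S' T'"
  unfolding far_apart_def by blast

lemma far_apart_Union:
  assumes "\<And>S T. S \<in> \<A> \<Longrightarrow> T \<in> \<B> \<Longrightarrow> far_apart \<delta> S T"
  shows "far_apart \<delta> (\<Union>\<A>) (\<Union>\<B>)"
  using assms unfolding far_apart_def by blast

lemma far_apart_imp_disjoint: "far_apart \<delta> S T \<Longrightarrow> 0 \<le> \<delta> \<Longrightarrow> S \<inter> T = {}"
  unfolding far_apart_def using dist_refl by force

lemma sum_Union_far_apart:
  assumes "pairwise (far_apart \<delta>) \<S>" "0 \<le> \<delta>" "\<And>S. S \<in> \<S> \<Longrightarrow> finite S"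
  shows "sum m (\<Union>\<S>) = (\<Sum>S\<in>\<S>. sum m S)"
proof -
  have "S \<inter> T = {}" if "S \<in> \<S>" "T \<in> \<S>" "S \<noteq> T" for S T
    using assms(1,2) that by (intro far_apart_imp_disjoint) (auto simp: pairwise_def)
  then show ?thesis using assms(3) by (simp add: sum.Union_disjoint)
qed

lemma ball_doubling_if_few_cells:
  fixes cell :: "'a \<Rightarrow> 'a \<Rightarrow> 'b"
  assumes "finite V" and m: "\<And>u. u \<in> V \<Longrightarrow> 0 \<le> m u"
    and few: "\<And>c. real (card (cell c ` ball_in V c r)) \<le> K"
    and small: "\<And>c u v. cell c u = cell c v \<Longrightarrow> \<rho> u v \<le> r / 2"
  shows "ball_doubling m K r V"
  unfolding ball_doubling_def
proof (intro allI impI ballI)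
  fix R c assume R: "R \<subseteq> V" "c \<in> R"
  have "finite R" using R(1) assms(1) by (rule finite_subset)
  let ?B = "ball_in R c r" and ?h = "\<lambda>p. sum m (ball_in R p (r / 2))"
  obtain p where "p \<in> R" and p_max: "Max (?h ` R) = ?h p"
    using obtains_MAX[OF \<open>finite R\<close>, of ?h] R(2) by blast
  have h_le: "?h q \<le> ?h p" if "q \<in> R" for q
    unfolding p_max[symmetric] using \<open>finite R\<close> that by (intro Max_ge) auto
  have "finite ?B" using \<open>finite R\<close> by (simp add: ball_in_def)
  then have "sum m ?B = (\<Sum>z\<in>cell c ` ?B. sum m {u\<in>?B. cell c u = z})" by (rule sum.image_gen)
  also have "\<dots> \<le> (\<Sum>z\<in>cell c ` ?B. ?h p)"
  proof (intro sum_mono)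
    fix z assume "z \<in> cell c ` ?B"
    then obtain q where q: "q \<in> ?B" "z = cell c q" by blast
    have "sum m {u\<in>?B. cell c u = z} \<le> ?h q"
      using R(1) m small[of c q] q(2) \<open>finite R\<close> by (intro sum_mono2) (auto simp: ball_in_def)
    also have "\<dots> \<le> ?h p" using q(1) by (intro h_le) (simp add: ball_in_def)
    finally show "sum m {u\<in>?B. cell c u = z} \<le> ?h p" .
  qed
  also have "\<dots> = real (card (cell c ` ?B)) * ?h p" by simp
  also have "\<dots> \<le> K * ?h p"
  proof (intro mult_right_mono sum_nonneg)
    show "0 \<le> m u" if "u \<in> ball_in R p (r / 2)" for u
      using that R(1) by (intro m) (auto simp: ball_in_def)
    have "card (cell c ` ?B) \<le> card (cell c ` ball_in V c r)"
      using R(1) assms(1) by (intro card_mono image_mono) (auto simp: ball_in_def)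
    then show "real (card (cell c ` ?B)) \<le> K" using few[of c] by linarith
  qed
  finally show "\<exists>p\<in>R. sum m ?B \<le> K * ?h p" using \<open>p \<in> R\<close> by blast
qed

lemma exists_ball_with_light_shell:
  assumes "finite V" "V \<noteq> {}" "0 < r" "0 < J" "0 \<le> q" and doubling: "ball_doubling m (q ^ J) r V"
  obtains c s where "c \<in> V" "0 \<le> s" "s \<le> r"
    "sum m (ball_in V c (s + r / (2 * real J))) \<le> q * sum m (ball_in V c s)"
proof -
  let ?h = "\<lambda>p. sum m (ball_in V p (r / 2))"
  obtain c where "c \<in> V" and c_max: "Max (?h ` V) = ?h c" using obtains_MAX[OF assms(1,2)] .
  have h_le: "?h p \<le> ?h c" if "p \<in> V" for p
    unfolding c_max[symmetric] using assms(1) that by (intro Max_ge) auto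
  define a where "a j = sum m (ball_in V c (r / 2 + real j * (r / (2 * real J))))" for j
  obtain p where p: "p \<in> V" "sum m (ball_in V c r) \<le> q ^ J * ?h p"
    using doubling \<open>c \<in> V\<close> unfolding ball_doubling_def by blast
  have "r / 2 + real J * (r / (2 * real J)) = r" using assms(4) by simp
  then have "a J = sum m (ball_in V c r)" unfolding a_def by (simp only:)
  also note p(2)
  also have "q ^ J * ?h p \<le> q ^ J * a 0"
    unfolding a_def using h_le[OF p(1)] assms(5) by (simp add: mult_left_mono)
  finally obtain j where j: "j < J" "a (Suc j) \<le> q * a j"
    using exists_slow_growth_step[OF assms(4,5)] by blast
  let ?s = "r / 2 + real j * (r / (2 * real J))"
  have "real j * (r / (2 * real J)) \<le> real J * (r / (2 * real J))"
    using j(1) assms(3) by (intro mult_right_mono) auto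
  moreover have "real J * (r / (2 * real J)) = r / 2" using assms(4) by simp
  ultimately have "?s \<le> r" by linarith
  moreover have "a (Suc j) = sum m (ball_in V c (?s + r / (2 * real J)))"
    unfolding a_def by (simp add: algebra_simps add_divide_distrib)
  ultimately show ?thesis
    using \<open>c \<in> V\<close> j(2) assms(3) by (intro that[of c ?s]) (auto simp: a_def)
qed

definition carving :: "real \<Rightarrow> real \<Rightarrow> 'a set \<Rightarrow> 'a set set \<Rightarrow> bool" where
  "carving r \<delta> V \<S> \<longleftrightarrow>
     (\<forall>S\<in>\<S>. S \<subseteq> V \<and> (\<exists>c\<in>V. \<forall>u\<in>S. \<rho> c u \<le> r)) \<and> pairwise (far_apart \<delta>) \<S>"

lemma carving_finite: "carving r \<delta> V \<S> \<Longrightarrow> finite V \<Longrightarrow> finite \<S>"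
  unfolding carving_def by (rule finite_subset[of \<S> "Pow V"]) auto

lemma carving_insert_ball:
  assumes carving: "carving r \<delta> (V - ball_in V c (s + \<delta>)) \<S>" and "c \<in> V" "s \<le> r"
  shows "carving r \<delta> V (insert (ball_in V c s) \<S>)"
proof -
  let ?B = "ball_in V c s" and ?V' = "V - ball_in V c (s + \<delta>)"
  have far: "far_apart \<delta> ?B ?V'"
    unfolding far_apart_def
  proof (intro ballI)
    fix u v assume "u \<in> ?B" "v \<in> ?V'"
    then have "\<rho> c u \<le> s" "s + \<delta> < \<rho> c v" by (auto simp: ball_in_def)
    then show "\<delta> < \<rho> u v" using dist_triangle[of c v u] by linarith
  qed
  have "S \<subseteq> V \<and> (\<exists>c\<in>V. \<forall>u\<in>S. \<rho> c u \<le> r)" if S: "S \<in> insert ?B \<S>" for S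
  proof (cases "S = ?B")
    case True
    then show ?thesis using assms(2,3) by (auto simp: ball_in_def intro!: bexI[of _ c])
  next
    case False
    then have "S \<in> \<S>" using S by simp
    then obtain c' where "S \<subseteq> ?V'" "c' \<in> ?V'" "\<forall>u\<in>S. \<rho> c' u \<le> r"
      using carving unfolding carving_def by meson
    then show ?thesis by (intro conjI bexI[of _ c']) auto
  qed
  moreover have "pairwise (far_apart \<delta>) (insert ?B \<S>)"
  proof -
    have "far_apart \<delta> ?B S" if "S \<in> \<S>" for S
      using far_apart_mono[OF far subset_refl] carving that by (simp add: carving_def)
    then show ?thesis using carving far_apart_commute by (simp add: pairwise_insert carving_def)
  qed
  ultimately show ?thesis by (simp add: carving_def)
qed

text \<open>Doubling forces one of \<open>J\<close> consecutive shells to be light; cutting there loses little mass.\<close>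
lemma ball_carving:
  assumes "finite V" "0 < r" "0 < J" "0 \<le> q" "ball_doubling m (q ^ J) r V"
  shows "\<exists>\<S>. carving r (r / (2 * real J)) V \<S> \<and> sum m V \<le> q * (\<Sum>S\<in>\<S>. sum m S)"
  using assms(1,5)
proof (induction V rule: finite_psubset_induct)
  case (psubset V)
  show ?case
  proof (cases "V = {}")
    case True
    then show ?thesis by (intro exI[of _ "{}"]) (auto simp: carving_def)
  next
    case False
    let ?\<delta> = "r / (2 * real J)"
    obtain c s where c: "c \<in> V" and s: "0 \<le> s" "s \<le> r"
      and light_shell: "sum m (ball_in V c (s + ?\<delta>)) \<le> q * sum m (ball_in V c s)"
      using exists_ball_with_light_shell[OF psubset.hyps False assms(2-4) psubset.prems] by blast
    let ?B = "ball_in V c s" and ?V' = "V - ball_in V c (s + ?\<delta>)"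
    have c_in_ball: "c \<in> ?B" "c \<in> ball_in V c (s + ?\<delta>)"
      using c s(1) assms(2) by (auto simp: ball_in_def dist_refl)
    then have "?V' \<subset> V" using c by auto
    moreover have "ball_doubling m (q ^ J) r ?V'"
      using psubset.prems by (auto simp: ball_doubling_def)
    ultimately obtain \<S> where carved: "carving r ?\<delta> ?V' \<S>"
      and mass: "sum m ?V' \<le> q * (\<Sum>S\<in>\<S>. sum m S)"
      using psubset.IH by blast
    have "?B \<notin> \<S>" using carved c_in_ball unfolding carving_def by blast
    moreover have "finite \<S>" using carving_finite[OF carved] psubset.hyps by simp
    moreover have "sum m V = sum m ?V' + sum m (ball_in V c (s + ?\<delta>))"
      using psubset.hyps by (intro sum.subset_diff) (auto simp: ball_in_def)
    ultimately have "sum m V \<le> q * (\<Sum>S\<in>insert ?B \<S>. sum m S)"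
      using light_shell mass by (simp add: distrib_left)
    then show ?thesis using carving_insert_ball[OF carved c s(2)] by blast
  qed
qed

definition set_dist :: "'a set \<Rightarrow> 'a \<Rightarrow> real" where
  "set_dist S u = Min (\<rho> u ` S)"

definition cutoff :: "real \<Rightarrow> 'a set \<Rightarrow> 'a \<Rightarrow> real" where
  "cutoff \<delta> S u = max 0 (1 - 2 / \<delta> * set_dist S u)"

context
  fixes S :: "'a set"
  assumes S: "finite S" "S \<noteq> {}"
begin

lemma set_dist_attained: "\<exists>s\<in>S. set_dist S u = \<rho> u s"
  unfolding set_dist_def using obtains_MIN[OF S, of "\<rho> u"] by blast

lemma set_dist_le: "s \<in> S \<Longrightarrow> set_dist S u \<le> \<rho> u s"
  unfolding set_dist_def using S by (intro Min_le) auto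

lemma set_dist_nonneg: "0 \<le> set_dist S u"
  using set_dist_attained[of u] dist_nonneg by auto

lemma set_dist_lipschitz: "\<bar>set_dist S u - set_dist S v\<bar> \<le> \<rho> u v"
proof -
  have "set_dist S u \<le> \<rho> u v + set_dist S v" for u v
  proof -
    obtain s where "s \<in> S" "set_dist S v = \<rho> v s" using set_dist_attained by blast
    then show ?thesis using set_dist_le[of s u] dist_triangle[of u s v] by linarith
  qed
  from this[of u v] this[of v u] show ?thesis using dist_commute[of u v] by linarith
qed

lemma cutoff_range:
  assumes "0 < \<delta>"
  shows "0 \<le> cutoff \<delta> S u" "cutoff \<delta> S u \<le> 1"
  using set_dist_nonneg[of u] assms by (auto simp: cutoff_def)

lemma cutoff_eq_1: "u \<in> S \<Longrightarrow> cutoff \<delta> S u = 1"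
  using set_dist_le[of u u] set_dist_nonneg[of u] by (simp add: cutoff_def dist_refl)

lemma cutoff_lipschitz:
  assumes "0 < \<delta>"
  shows "\<bar>cutoff \<delta> S u - cutoff \<delta> S v\<bar> \<le> 2 / \<delta> * \<rho> u v"
proof -
  have "\<bar>cutoff \<delta> S u - cutoff \<delta> S v\<bar> \<le> \<bar>2 / \<delta> * set_dist S u - 2 / \<delta> * set_dist S v\<bar>"
    by (auto simp: cutoff_def)
  also have "\<dots> = 2 / \<delta> * \<bar>set_dist S u - set_dist S v\<bar>"
    unfolding right_diff_distrib[symmetric] abs_mult using assms by simp
  also have "\<dots> \<le> 2 / \<delta> * \<rho> u v" using set_dist_lipschitz assms by (intro mult_left_mono) auto
  finally show ?thesis .
qed

lemma cutoff_support:
  assumes "0 < \<delta>" "cutoff \<delta> S u \<noteq> 0"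
  shows "\<exists>s\<in>S. \<rho> u s < \<delta> / 2"
proof -
  have "2 / \<delta> * set_dist S u < 1" using assms(2) unfolding cutoff_def by linarith
  then have "set_dist S u < \<delta> / 2" using assms(1) by (simp add: field_simps)
  then show ?thesis using set_dist_attained[of u] by auto
qed

end

lemma cutoffs_disjoint:
  assumes "finite S" "S \<noteq> {}" "finite T" "T \<noteq> {}" "0 < \<delta>" "far_apart \<delta> S T"
  shows "cutoff \<delta> S u = 0 \<or> cutoff \<delta> T u = 0"
proof (rule ccontr)
  assume "\<not> ?thesis"
  then obtain s t where st: "s \<in> S" "\<rho> u s < \<delta> / 2" "t \<in> T" "\<rho> u t < \<delta> / 2"
    using cutoff_support[OF assms(1,2,5)] cutoff_support[OF assms(3,4,5)] by meson
  have "\<delta> < \<rho> s t" using assms(6) st(1,3) unfolding far_apart_def by blast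
  then show False using dist_triangle[of s t u] dist_commute[of s u] st(2,4) by linarith
qed

end

section \<open>The distance between lines through the origin\<close>

lemma sum_half_powers_int: "(\<Sum>z\<in>{- int n..int n}. (1 / 2 :: real) ^ nat \<bar>z\<bar>) = 3 - 2 * (1 / 2) ^ n"
proof (induction n)
  case (Suc n)
  have "{- int (Suc n)..int (Suc n)}
      = insert (int (Suc n)) (insert (- int (Suc n)) {- int n..int n})" by auto
  then have "(\<Sum>z\<in>{- int (Suc n)..int (Suc n)}. (1 / 2 :: real) ^ nat \<bar>z\<bar>)
     = (1 / 2) ^ Suc n + ((1 / 2) ^ Suc n + (\<Sum>z\<in>{- int n..int n}. (1 / 2) ^ nat \<bar>z\<bar>))"
    by (simp add: nat_add_distrib)
  then show ?case using Suc by simp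
qed simp

definition lattice_ball :: "nat \<Rightarrow> nat \<Rightarrow> (nat \<Rightarrow> int) set" where
  "lattice_ball k n = {z \<in> {..<k} \<rightarrow>\<^sub>E UNIV. (\<Sum>i<k. \<bar>z i\<bar>) \<le> int n}"

lemma lattice_ball_subset_cube: "lattice_ball k n \<subseteq> {..<k} \<rightarrow>\<^sub>E {- int n..int n}"
proof
  fix z assume z: "z \<in> lattice_ball k n"
  have "z i \<in> {- int n..int n}" if "i < k" for i
  proof -
    have "\<bar>z i\<bar> \<le> (\<Sum>i<k. \<bar>z i\<bar>)" using that by (intro member_le_sum) auto
    also have "\<dots> \<le> int n" using z by (simp add: lattice_ball_def)
    finally show ?thesis by auto
  qed
  then show "z \<in> {..<k} \<rightarrow>\<^sub>E {- int n..int n}" using z by (auto simp: lattice_ball_def PiE_iff)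
qed

lemma finite_lattice_ball: "finite (lattice_ball k n)"
  using lattice_ball_subset_cube by (rule finite_subset) (intro finite_PiE, auto)

text \<open>Each point of the ball has weight at least \<open>(1 / 2) ^ n\<close> under the product of the weights
  \<open>(1 / 2) ^ \<bar>z i\<bar>\<close>.\<close>
lemma card_lattice_ball_le: "real (card (lattice_ball k n)) \<le> 2 ^ n * 3 ^ k"
proof -
  let ?cube = "{..<k} \<rightarrow>\<^sub>E {- int n..int n}"
  let ?weight = "\<lambda>z. \<Prod>i<k. (1 / 2 :: real) ^ nat \<bar>z i\<bar>"
  have "real (card (lattice_ball k n)) = (\<Sum>z\<in>lattice_ball k n. 1)" by simp
  also have "\<dots> \<le> (\<Sum>z\<in>lattice_ball k n. 2 ^ n * ?weight z)"
  proof (intro sum_mono)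
    fix z assume "z \<in> lattice_ball k n"
    then have "int (\<Sum>i<k. nat \<bar>z i\<bar>) \<le> int n" by (simp add: lattice_ball_def)
    then have "(\<Sum>i<k. nat \<bar>z i\<bar>) \<le> n" by linarith
    then have "(1 / 2 :: real) ^ n \<le> (1 / 2) ^ (\<Sum>i<k. nat \<bar>z i\<bar>)" by (intro power_decreasing) auto
    then have "2 ^ n * (1 / 2) ^ n \<le> 2 ^ n * ?weight z"
      unfolding power_sum by (intro mult_left_mono) auto
    then show "1 \<le> 2 ^ n * ?weight z" by (simp flip: power_mult_distrib)
  qed
  also have "\<dots> \<le> (\<Sum>z\<in>?cube. 2 ^ n * ?weight z)"
    using lattice_ball_subset_cube
    by (intro sum_mono2) (auto intro!: finite_PiE mult_nonneg_nonneg prod_nonneg)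
  also have "\<dots> = 2 ^ n * (\<Prod>i<k. \<Sum>z\<in>{- int n..int n}. (1 / 2 :: real) ^ nat \<bar>z\<bar>)"
    unfolding sum_distrib_left[symmetric] by (subst prod_sum_PiE) auto
  also have "\<dots> \<le> 2 ^ n * (\<Prod>i<k. 3)"
    unfolding sum_half_powers_int
    using power_le_one[of "1 / 2 :: real" n] by (intro mult_left_mono prod_mono) auto
  finally show ?thesis by simp
qed

lemma L2_set_uminus: "L2_set (\<lambda>i. - x i) A = L2_set x A"
  by (simp add: L2_set_def)

lemma L2_set_minus_commute: "L2_set (\<lambda>i. x i - y i) A = L2_set (\<lambda>i. y i - x i) A"
  using L2_set_uminus[of "\<lambda>i. x i - y i" A] by simp

lemma L2_set_scale: "L2_set (\<lambda>i. c * x i) A = \<bar>c\<bar> * L2_set x A"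
  by (simp add: L2_set_def power_mult_distrib sum_distrib_left[symmetric] real_sqrt_mult)

lemma L2_set_power2: "(L2_set x A)\<^sup>2 = (\<Sum>i\<in>A. (x i)\<^sup>2)"
  unfolding L2_set_def by (simp add: sum_nonneg)

text \<open>The distance of the lines spanned by \<open>x\<close> and \<open>y\<close> when these are unit vectors of \<open>\<real>\<^sup>k\<close>.\<close>
definition proj_dist :: "nat \<Rightarrow> (nat \<Rightarrow> real) \<Rightarrow> (nat \<Rightarrow> real) \<Rightarrow> real" where
  "proj_dist k x y = min (L2_set (\<lambda>i. x i - y i) {..<k}) (L2_set (\<lambda>i. x i + y i) {..<k})"

lemma proj_dist_commute: "proj_dist k x y = proj_dist k y x"
  unfolding proj_dist_def L2_set_minus_commute[of x y] by (simp add: add.commute)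

lemma proj_dist_attained: "\<exists>s\<in>{1, -1}. proj_dist k x y = L2_set (\<lambda>i. s * y i - x i) {..<k}"
proof (cases "L2_set (\<lambda>i. x i - y i) {..<k} \<le> L2_set (\<lambda>i. x i + y i) {..<k}")
  case True
  then show ?thesis using L2_set_minus_commute[of x y "{..<k}"] by (simp add: proj_dist_def)
next
  case False
  moreover have "L2_set (\<lambda>i. - y i - x i) {..<k} = L2_set (\<lambda>i. x i + y i) {..<k}"
  proof -
    have "(\<lambda>i. - y i - x i) = (\<lambda>i. - (x i + y i))" by auto
    then show ?thesis by (simp only: L2_set_uminus)
  qed
  ultimately show ?thesis by (simp add: proj_dist_def)
qed

lemma proj_dist_le_signed:
  assumes "s \<in> {1, -1}" "t \<in> {1, -1}"
  shows "proj_dist k x y \<le> L2_set (\<lambda>i. s * x i - t * y i) {..<k}"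
proof -
  have "L2_set (\<lambda>i. - x i - y i) {..<k} = L2_set (\<lambda>i. x i + y i) {..<k}"
    using L2_set_uminus[of "\<lambda>i. x i + y i" "{..<k}"] by simp
  moreover have "L2_set (\<lambda>i. - x i + y i) {..<k} = L2_set (\<lambda>i. x i - y i) {..<k}"
    using L2_set_uminus[of "\<lambda>i. x i - y i" "{..<k}"] by (simp add: algebra_simps)
  ultimately show ?thesis using assms unfolding proj_dist_def by auto
qed

lemma proj_dist_triangle: "proj_dist k x z \<le> proj_dist k x y + proj_dist k y z"
proof -
  obtain s where s: "s \<in> {1, -1}" "proj_dist k y x = L2_set (\<lambda>i. s * x i - y i) {..<k}"
    using proj_dist_attained by blast
  obtain t where t: "t \<in> {1, -1}" "proj_dist k y z = L2_set (\<lambda>i. t * z i - y i) {..<k}"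
    using proj_dist_attained by blast
  have "proj_dist k x z \<le> L2_set (\<lambda>i. s * x i - t * z i) {..<k}"
    using s(1) t(1) by (rule proj_dist_le_signed)
  also have "\<dots> = L2_set (\<lambda>i. (s * x i - y i) + (y i - t * z i)) {..<k}" by simp
  also have "\<dots> \<le> L2_set (\<lambda>i. s * x i - y i) {..<k} + L2_set (\<lambda>i. y i - t * z i) {..<k}"
    by (rule L2_set_triangle_ineq)
  finally show ?thesis
    using s(2) t(2) by (simp add: L2_set_minus_commute[of y] proj_dist_commute[of k x y])
qed

lemma pseudo_metric_proj_dist: "pseudo_metric (\<lambda>u v. proj_dist k (e u) (e v))"
proof
  show "proj_dist k (e u) (e u) = 0" for u by (simp add: proj_dist_def L2_set_0' min_def)
qed (rule proj_dist_commute proj_dist_triangle)+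

lemma sum_abs_floor_le:
  "(\<Sum>i<k. \<bar>real_of_int \<lfloor>x i\<rfloor>\<bar>) \<le> sqrt (real k) * L2_set x {..<k} + real k"
proof -
  have "(\<Sum>i<k. \<bar>real_of_int \<lfloor>x i\<rfloor>\<bar>) \<le> (\<Sum>i<k. \<bar>x i\<bar> + 1)" by (intro sum_mono) linarith
  also have "\<dots> = (\<Sum>i<k. \<bar>1\<bar> * \<bar>x i\<bar>) + real k" by (simp add: sum.distrib)
  also have "(\<Sum>i<k. \<bar>1\<bar> * \<bar>x i\<bar>) \<le> sqrt (real k) * L2_set x {..<k}"
    using L2_set_mult_ineq[of "\<lambda>_. 1" x "{..<k}"] by (simp add: L2_set_constant)
  finally show ?thesis by simp
qed

lemma floor_in_lattice_ball:
  assumes "sqrt (real k) * L2_set x {..<k} + real k \<le> real n"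
  shows "restrict (\<lambda>i. \<lfloor>x i\<rfloor>) {..<k} \<in> lattice_ball k n"
proof -
  have "real_of_int (\<Sum>i<k. \<bar>\<lfloor>x i\<rfloor>\<bar>) \<le> real_of_int (int n)"
    using order_trans[OF sum_abs_floor_le assms] by simp
  then show ?thesis unfolding of_int_le_iff by (simp add: lattice_ball_def)
qed

lemma L2_set_diff_le_if_same_floor:
  assumes "\<And>i. i < k \<Longrightarrow> \<lfloor>x i\<rfloor> = \<lfloor>y i\<rfloor>"
  shows "L2_set (\<lambda>i. x i - y i) {..<k} \<le> sqrt (real k)"
proof -
  have "\<bar>x i - y i\<bar> \<le> 1" if "i < k" for i using assms[OF that] by linarith
  then have "L2_set (\<lambda>i. \<bar>x i - y i\<bar>) {..<k} \<le> L2_set (\<lambda>_. 1) {..<k}"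
    by (intro L2_set_mono) auto
  then show ?thesis by (simp add: L2_set_constant L2_set_def)
qed

text \<open>After choosing signs, rounding at scale \<open>r / (2 * sqrt k)\<close> separates points at distance above
  \<open>r / 2\<close>.\<close>
lemma proj_dist_rounding:
  assumes "1 \<le> k" "0 < r"
  obtains cell :: "(nat \<Rightarrow> real) \<Rightarrow> nat \<Rightarrow> int"
  where "\<And>y. proj_dist k x y \<le> r \<Longrightarrow> cell y \<in> lattice_ball k (3 * k)"
    "\<And>y z. cell y = cell z \<Longrightarrow> proj_dist k y z \<le> r / 2"
proof -
  define a where "a = 2 * sqrt (real k) / r"
  have a_pos: "0 < a" and a_r: "sqrt (real k) * (a * r) = 2 * real k" "sqrt (real k) = a * (r / 2)"
    using assms by (auto simp: a_def)
  have "\<forall>y. \<exists>s\<in>{1, -1}. proj_dist k x y = L2_set (\<lambda>i. s * y i - x i) {..<k}"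
    using proj_dist_attained by blast
  then obtain s where sign: "\<And>y. s y \<in> {1, -1}"
    and dist_eq: "\<And>y. proj_dist k x y = L2_set (\<lambda>i. s y * y i - x i) {..<k}" by metis
  define scaled where "scaled y i = a * (s y * y i - x i)" for y i
  define cell where "cell y = restrict (\<lambda>i. \<lfloor>scaled y i\<rfloor>) {..<k}" for y
  show ?thesis
  proof
    fix y assume near: "proj_dist k x y \<le> r"
    have "L2_set (scaled y) {..<k} = a * proj_dist k x y"
      unfolding scaled_def dist_eq L2_set_scale using a_pos by simp
    then have "sqrt (real k) * L2_set (scaled y) {..<k} \<le> sqrt (real k) * (a * r)"
      using near a_pos by (intro mult_left_mono) auto
    then show "cell y \<in> lattice_ball k (3 * k)"
      unfolding cell_def a_r(1) by (intro floor_in_lattice_ball) simp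
  next
    fix y z assume same: "cell y = cell z"
    have "a * L2_set (\<lambda>i. s y * y i - s z * z i) {..<k}
        = L2_set (\<lambda>i. scaled y i - scaled z i) {..<k}"
      using a_pos L2_set_scale[of a "\<lambda>i. s y * y i - s z * z i" "{..<k}"]
      by (simp add: scaled_def algebra_simps)
    also have "\<dots> \<le> sqrt (real k)"
    proof (rule L2_set_diff_le_if_same_floor)
      show "\<lfloor>scaled y i\<rfloor> = \<lfloor>scaled z i\<rfloor>" if "i < k" for i
        using fun_cong[OF same, of i] that by (simp add: cell_def)
    qed
    finally have "L2_set (\<lambda>i. s y * y i - s z * z i) {..<k} \<le> r / 2"
      unfolding a_r(2) using a_pos by simp
    then show "proj_dist k y z \<le> r / 2" using proj_dist_le_signed[OF sign sign] order_trans by blast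
  qed
qed

lemma proj_dist_ball_doubling:
  assumes "finite V" "\<And>u. u \<in> V \<Longrightarrow> 0 \<le> m u" "1 \<le> k" "0 < r" and K: "24 ^ k \<le> K"
  shows "pseudo_metric.ball_doubling (\<lambda>u v. proj_dist k (e u) (e v)) m K r V"
proof -
  interpret pseudo_metric "\<lambda>u v. proj_dist k (e u) (e v)" by (rule pseudo_metric_proj_dist)
  have "\<forall>x. \<exists>cell :: _ \<Rightarrow> nat \<Rightarrow> int. (\<forall>y. proj_dist k x y \<le> r \<longrightarrow> cell y \<in> lattice_ball k (3 * k)) \<and>
      (\<forall>y z. cell y = cell z \<longrightarrow> proj_dist k y z \<le> r / 2)"
    using proj_dist_rounding[OF assms(3,4)] by metis
  then obtain cell :: "(nat \<Rightarrow> real) \<Rightarrow> (nat \<Rightarrow> real) \<Rightarrow> nat \<Rightarrow> int"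
    where cell: "\<And>x y. proj_dist k x y \<le> r \<Longrightarrow> cell x y \<in> lattice_ball k (3 * k)"
      "\<And>x y z. cell x y = cell x z \<Longrightarrow> proj_dist k y z \<le> r / 2" by metis
  show ?thesis
  proof (rule ball_doubling_if_few_cells[where cell = "\<lambda>c u. cell (e c) (e u)"])
    fix c
    have "card ((\<lambda>u. cell (e c) (e u)) ` ball_in V c r) \<le> card (lattice_ball k (3 * k))"
      using cell(1) by (intro card_mono finite_lattice_ball) (auto simp: ball_in_def)
    also have "real (card (lattice_ball k (3 * k))) \<le> 2 ^ (3 * k) * 3 ^ k"
      by (rule card_lattice_ball_le)
    also have "\<dots> = 24 ^ k" by (simp add: power_mult power_mult_distrib[symmetric])
    also note K
    finally show "real (card ((\<lambda>u. cell (e c) (e u)) ` ball_in V c r)) \<le> K" by simp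
  qed (use assms cell(2) in auto)
qed

lemma proj_dist_correlation:
  assumes x: "(\<Sum>i<k. (x i)\<^sup>2) = 1" and y: "(\<Sum>i<k. (y i)\<^sup>2) = 1"
  shows "1 - (proj_dist k x y)\<^sup>2 \<le> (\<Sum>i<k. x i * y i)\<^sup>2"
proof -
  let ?p = "\<Sum>i<k. x i * y i"
  obtain s where s: "s \<in> {1, -1}" "proj_dist k x y = L2_set (\<lambda>i. s * y i - x i) {..<k}"
    using proj_dist_attained by blast
  have "(proj_dist k x y)\<^sup>2 = (\<Sum>i<k. s\<^sup>2 * (y i)\<^sup>2 + (x i)\<^sup>2 - 2 * s * (x i * y i))"
    unfolding s(2) L2_set_power2 by (intro sum.cong refl) (simp add: power2_eq_square algebra_simps)
  also have "\<dots> = s\<^sup>2 + 1 - 2 * s * ?p"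
    unfolding sum_subtractf sum.distrib sum_distrib_left[symmetric] x y by simp
  finally have "1 - (proj_dist k x y)\<^sup>2 = 2 * s * ?p - s\<^sup>2" by simp
  also have "\<dots> \<le> ?p\<^sup>2" using zero_le_power2[of "s - ?p"] by (simp add: power2_diff)
  finally show ?thesis .
qed

lemma proj_dist_normalized_le:
  assumes "L2_set x {..<k} \<noteq> 0" "L2_set y {..<k} \<noteq> 0"
  shows "proj_dist k (\<lambda>i. x i / L2_set x {..<k}) (\<lambda>i. y i / L2_set y {..<k}) * L2_set y {..<k}
    \<le> 2 * L2_set (\<lambda>i. x i + y i) {..<k}"
proof -
  define nx ny where "nx = L2_set x {..<k}" and "ny = L2_set y {..<k}"
  let ?s = "L2_set (\<lambda>i. x i + y i) {..<k}"
  have pos: "0 < nx" "0 < ny" using assms by (simp_all add: nx_def ny_def less_le)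
  have "proj_dist k (\<lambda>i. x i / nx) (\<lambda>i. y i / ny) * ny
      \<le> L2_set (\<lambda>i. x i / nx + y i / ny) {..<k} * ny"
    using pos unfolding proj_dist_def by (intro mult_right_mono) auto
  also have "\<dots> = L2_set (\<lambda>i. ny * (x i / nx + y i / ny)) {..<k}"
    unfolding L2_set_scale using pos by simp
  also have "(\<lambda>i. ny * (x i / nx + y i / ny)) = (\<lambda>i. (x i + y i) + (ny - nx) / nx * x i)"
    using pos by (auto simp: field_simps)
  also have "L2_set \<dots> {..<k} \<le> ?s + L2_set (\<lambda>i. (ny - nx) / nx * x i) {..<k}"
    by (rule L2_set_triangle_ineq)
  also have "L2_set (\<lambda>i. (ny - nx) / nx * x i) {..<k} = \<bar>ny - nx\<bar>"
    unfolding L2_set_scale nx_def[symmetric] using pos by simp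
  also have "\<bar>ny - nx\<bar> \<le> ?s"
    using L2_set_triangle_ineq[of "\<lambda>i. x i + y i" "\<lambda>i. - x i" "{..<k}"]
      L2_set_triangle_ineq[of "\<lambda>i. x i + y i" "\<lambda>i. - y i" "{..<k}"]
    by (simp add: L2_set_uminus nx_def ny_def abs_le_iff)
  finally show ?thesis by (simp add: nx_def ny_def)
qed

section \<open>Localization of the eigenfunctions\<close>

lemma power_24_le_growth:
  assumes "1 \<le> k"
  shows "(24 :: real) ^ k \<le> (1 + 1 / (8 * real k)) ^ (40 * k\<^sup>2)"
proof -
  have "(2 :: real) \<le> 1 + real (8 * k) * (1 / (8 * real k))" using assms by simp
  also have "\<dots> \<le> (1 + 1 / (8 * real k)) ^ (8 * k)"
    by (rule Bernoulli_inequality) (simp add: order_trans[of _ 0])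
  finally have "(2 :: real) ^ (5 * k) \<le> ((1 + 1 / (8 * real k)) ^ (8 * k)) ^ (5 * k)"
    by (intro power_mono) auto
  moreover have "(24 :: real) ^ k \<le> 2 ^ (5 * k)" unfolding power_mult by (intro power_mono) auto
  moreover have "8 * k * (5 * k) = 40 * k\<^sup>2" by (simp add: power2_eq_square)
  ultimately show ?thesis by (simp flip: power_mult)
qed

lemma exists_index_with_ratio_le:
  fixes a b :: "'i \<Rightarrow> real"
  assumes "finite J" and nonneg: "\<And>j. j \<in> J \<Longrightarrow> 0 \<le> a j" "\<And>j. j \<in> J \<Longrightarrow> 0 \<le> b j"
    and "sum a J \<le> c * sum b J" and "0 < sum b J"
  shows "\<exists>j\<in>J. 0 < b j \<and> a j \<le> c * b j"
proof (rule ccontr)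
  assume no: "\<not> ?thesis"
  have "\<exists>j\<in>J. 0 < b j"
    using sum_nonpos[of J b] assms(5) by (meson not_le)
  then have "\<exists>j\<in>J. c * b j < a j" using no by (meson not_le)
  moreover have "\<forall>j\<in>J. c * b j \<le> a j"
    using no nonneg by (metis less_eq_real_def mult_zero_right not_le)
  ultimately have "(\<Sum>j\<in>J. c * b j) < sum a J" using assms(1) by (intro sum_strict_mono_ex1)
  then show False using assms(4) by (simp add: sum_distrib_left)
qed

locale spectral_embedding = weighted_graph N w
  for N :: nat and w :: "nat \<Rightarrow> nat \<Rightarrow> real" +
  fixes k :: nat and f :: "nat \<Rightarrow> nat \<Rightarrow> real"
  assumes dim_pos: "1 \<le> k" and orthonormal: "orthonormal k f"
begin

definition len :: "nat \<Rightarrow> real" where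
  "len u = L2_set (\<lambda>i. f i u) {..<k}"

definition dir :: "nat \<Rightarrow> nat \<Rightarrow> real" where
  "dir u i = f i u / len u"

definition mass :: "nat \<Rightarrow> real" where
  "mass u = deg N w u * (len u)\<^sup>2"

definition line_dist :: "nat \<Rightarrow> nat \<Rightarrow> real" where
  "line_dist = (\<lambda>u v. proj_dist k (dir u) (dir v))"

sublocale pseudo_metric line_dist
  unfolding line_dist_def by (rule pseudo_metric_proj_dist)

lemma len_nonneg: "0 \<le> len u"
  by (simp add: len_def)

lemma mass_nonneg: "u < N \<Longrightarrow> 0 \<le> mass u"
  by (simp add: mass_def deg_nonneg)

lemma sum_mass_eq: "(\<Sum>u<N. deg N w u * (c u)\<^sup>2 * (len u)\<^sup>2) = (\<Sum>i<k. sqnorm (\<lambda>u. c u * f i u))"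
proof -
  have "(\<Sum>u<N. deg N w u * (c u)\<^sup>2 * (len u)\<^sup>2) = (\<Sum>u<N. \<Sum>i<k. deg N w u * (c u * f i u)\<^sup>2)"
    unfolding len_def L2_set_power2 by (simp add: sum_distrib_left power_mult_distrib mult.assoc)
  then show ?thesis unfolding sqnorm_def by (subst (asm) sum.swap)
qed

lemma total_mass: "sum mass (support len) = real k"
proof -
  have "sum mass (support len) = (\<Sum>u<N. deg N w u * 1\<^sup>2 * (len u)\<^sup>2)"
    unfolding mass_def by (intro sum.mono_neutral_cong_left) (auto simp: support_def)
  also have "\<dots> = (\<Sum>i<k. sqnorm (f i))" unfolding sum_mass_eq by simp
  also have "\<dots> = (\<Sum>i<k. 1)"
    using orthonormal by (intro sum.cong) (auto simp: orthonormal_def simp flip: deg_inner_self)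
  finally show ?thesis by simp
qed

lemma isotropic: "sqnorm (\<lambda>u. \<Sum>i<k. x i * f i u) = (\<Sum>i<k. (x i)\<^sup>2)"
proof -
  have "sqnorm (\<lambda>u. \<Sum>i<k. x i * f i u)
      = (\<Sum>u<N. \<Sum>i<k. \<Sum>j<k. x i * x j * (deg N w u * f i u * f j u))"
    unfolding sqnorm_def
    by (intro sum.cong refl) (simp add: power2_eq_square sum_product sum_distrib_left mult_ac)
  also have "\<dots> = (\<Sum>i<k. \<Sum>u<N. \<Sum>j<k. x i * x j * (deg N w u * f i u * f j u))" by (rule sum.swap)
  also have "\<dots> = (\<Sum>i<k. \<Sum>j<k. x i * x j * deg_inner (f i) (f j))"
    unfolding deg_inner_def sum_distrib_left by (intro sum.cong[OF refl] sum.swap)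
  also have "\<dots> = (\<Sum>i<k. \<Sum>j<k. if j = i then (x i)\<^sup>2 else 0)"
    using orthonormal by (intro sum.cong refl) (auto simp: orthonormal_def power2_eq_square)
  finally show ?thesis by simp
qed

lemma dir_unit: "u \<in> support len \<Longrightarrow> (\<Sum>i<k. (dir u i)\<^sup>2) = 1"
  unfolding dir_def power_divide sum_divide_distrib[symmetric] support_def
  by (simp add: len_def flip: L2_set_power2)

text \<open>Isotropy in the direction of the centre leaves little room for mass near its line.\<close>
lemma cluster_mass_le:
  assumes S: "S \<subseteq> support len" and c: "c \<in> support len" and near: "\<And>u. u \<in> S \<Longrightarrow> line_dist c u \<le> r"
  shows "(1 - r\<^sup>2) * sum mass S \<le> 1"
proof -
  have "(1 - r\<^sup>2) * mass u \<le> deg N w u * (\<Sum>i<k. dir c i * f i u)\<^sup>2" if u: "u \<in> S" for u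
  proof -
    have support: "u \<in> support len" "u < N" "len u \<noteq> 0" using u S by (auto simp: support_def)
    let ?p = "\<Sum>i<k. dir c i * dir u i"
    have "(line_dist c u)\<^sup>2 \<le> r\<^sup>2" using near[OF u] dist_nonneg by (intro power_mono)
    then have "1 - r\<^sup>2 \<le> ?p\<^sup>2"
      using proj_dist_correlation[OF dir_unit[OF c] dir_unit[OF support(1)]]
      unfolding line_dist_def by linarith
    then have "(1 - r\<^sup>2) * mass u \<le> ?p\<^sup>2 * mass u"
      using mass_nonneg[OF support(2)] by (rule mult_right_mono)
    also have "\<dots> = deg N w u * (?p * len u)\<^sup>2" by (simp add: mass_def power_mult_distrib)
    also have "?p * len u = (\<Sum>i<k. dir c i * f i u)"
      unfolding sum_distrib_right dir_def[of u] using support(3) by simp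
    finally show ?thesis .
  qed
  then have "(1 - r\<^sup>2) * sum mass S \<le> (\<Sum>u\<in>S. deg N w u * (\<Sum>i<k. dir c i * f i u)\<^sup>2)"
    unfolding sum_distrib_left by (rule sum_mono)
  also have "\<dots> \<le> sqnorm (\<lambda>u. \<Sum>i<k. dir c i * f i u)"
    unfolding sqnorm_def using S by (intro sum_mono2) (auto simp: deg_nonneg support_def)
  also have "\<dots> = 1" unfolding isotropic by (rule dir_unit[OF c])
  finally show ?thesis .
qed

text \<open>This radius keeps the mass of a cluster below \<open>1 + 1 / (8 * k)\<close>, and by
  \<open>power_24_le_growth\<close> there is room for \<open>40 * k\<^sup>2\<close> shells when carving with this loss.\<close>
definition radius :: real where
  "radius = 1 / (4 * sqrt (real k))"

definition sep :: real where
  "sep = radius / (2 * real (40 * k\<^sup>2))"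

lemma radius_power2: "radius\<^sup>2 = 1 / (16 * real k)"
  by (simp add: radius_def power_divide power_mult_distrib)

lemma radius_pos: "0 < radius"
  using dim_pos by (simp add: radius_def)

lemma sep_pos: "0 < sep"
  using dim_pos radius_pos by (simp add: sep_def)

lemma inverse_sep_power2: "1 / sep\<^sup>2 = 102400 * real k ^ 5"
proof -
  have "1 / sep\<^sup>2 = 6400 * ((real k)\<^sup>2)\<^sup>2 / radius\<^sup>2"
    by (simp add: sep_def power_divide power_mult_distrib)
  also have "\<dots> = 102400 * (real k ^ 4 * real k)" unfolding radius_power2 by (simp flip: power_mult)
  finally show ?thesis by (simp flip: power_Suc2)
qed

lemma sep_le_1: "sep \<le> 1"
proof -
  have "1 \<le> real k ^ 5" using dim_pos by (intro one_le_power) simp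
  then have "1 \<le> 1 / sep\<^sup>2" unfolding inverse_sep_power2 by linarith
  then have "sep\<^sup>2 \<le> 1\<^sup>2" using sep_pos by (simp add: field_simps)
  then show ?thesis by (rule power2_le_imp_le) simp
qed

lemma carved_clusters:
  "\<exists>\<S>. (\<forall>S\<in>\<S>. S \<subseteq> support len \<and> sum mass S \<le> 1 + 1 / (8 * real k)) \<and>
     pairwise (far_apart sep) \<S> \<and> real k \<le> (1 + 1 / (8 * real k)) * (\<Sum>S\<in>\<S>. sum mass S)"
proof -
  let ?q = "1 + 1 / (8 * real k)"
  have "ball_doubling mass (?q ^ (40 * k\<^sup>2)) radius (support len)"
    unfolding line_dist_def
    using mass_nonneg dim_pos radius_pos
    by (intro proj_dist_ball_doubling finite_support power_24_le_growth) (auto simp: support_def)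
  then obtain \<S> where carved: "carving radius sep (support len) \<S>"
    and mass: "sum mass (support len) \<le> ?q * (\<Sum>S\<in>\<S>. sum mass S)"
    using ball_carving[OF finite_support radius_pos, of "40 * k\<^sup>2" ?q mass len] dim_pos
    unfolding sep_def by auto
  have "sum mass S \<le> ?q" if S: "S \<in> \<S>" for S
  proof -
    have "0 < 1 - radius\<^sup>2" and "1 \<le> (1 - radius\<^sup>2) * ?q"
      unfolding radius_power2 using dim_pos by (simp_all add: field_simps)
    moreover obtain c where "c \<in> support len" "\<forall>u\<in>S. line_dist c u \<le> radius" "S \<subseteq> support len"
      using carved S unfolding carving_def by meson
    then have "(1 - radius\<^sup>2) * sum mass S \<le> 1" by (intro cluster_mass_le) auto
    ultimately have "(1 - radius\<^sup>2) * sum mass S \<le> (1 - radius\<^sup>2) * ?q" by linarith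
    then show ?thesis using \<open>0 < 1 - radius\<^sup>2\<close> by simp
  qed
  moreover have "\<forall>S\<in>\<S>. S \<subseteq> support len" "pairwise (far_apart sep) \<S>"
    using carved by (auto simp: carving_def)
  ultimately show ?thesis using mass unfolding total_mass by (intro exI[of _ \<S>]) simp
qed

lemma separated_clusters:
  "\<exists>S. (\<forall>i<k. S i \<subseteq> support len \<and> 1 / 2 \<le> sum mass (S i)) \<and>
    pairwise (\<lambda>i j. far_apart sep (S i) (S j)) {..<k}"
proof -
  let ?q = "1 + 1 / (8 * real k)"
  obtain \<S> where clusters: "\<forall>S\<in>\<S>. S \<subseteq> support len \<and> sum mass S \<le> ?q"
    and far: "pairwise (far_apart sep) \<S>" and total: "real k \<le> ?q * (\<Sum>S\<in>\<S>. sum mass S)"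
    using carved_clusters by blast
  have finite: "finite \<S>" "\<And>S. S \<in> \<S> \<Longrightarrow> finite S"
    using clusters finite_support finite_subset[of \<S> "Pow (support len)"]
    by (auto intro: finite_subset)
  have "?q * ((real k - 1) * ?q + 1 / 2) \<le> real k" using dim_pos by (simp add: field_simps)
  also note total
  finally have "(real k - 1) * ?q + 1 / 2 \<le> (\<Sum>S\<in>\<S>. sum mass S)"
    by (rule mult_left_le_imp_le) (simp add: add_pos_nonneg)
  moreover have "0 \<le> sum mass S" if "S \<in> \<S>" for S
    using clusters that mass_nonneg by (intro sum_nonneg) (auto simp: support_def)
  ultimately obtain H where H: "\<forall>i<k. H i \<subseteq> \<S> \<and> 1 / 2 \<le> (\<Sum>S\<in>H i. sum mass S)"
    and disjoint: "disjoint_family_on H {..<k}"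
    using disjoint_groups_of_large_sum[of \<S> "sum mass" ?q "1 / 2" k] finite(1) clusters by auto
  have "\<Union>(H i) \<subseteq> support len \<and> 1 / 2 \<le> sum mass (\<Union>(H i))" if "i < k" for i
  proof -
    have "H i \<subseteq> \<S>" using H that by blast
    then have "sum mass (\<Union>(H i)) = (\<Sum>S\<in>H i. sum mass S)"
      using pairwise_subset[OF far] finite(2) sep_pos by (intro sum_Union_far_apart[of sep]) auto
    then show ?thesis using H that \<open>H i \<subseteq> \<S>\<close> clusters by auto
  qed
  moreover have "far_apart sep (\<Union>(H i)) (\<Union>(H j))" if "i < k" "j < k" "i \<noteq> j" for i j
  proof (rule far_apart_Union)
    fix S T assume "S \<in> H i" "T \<in> H j"
    moreover have "H i \<inter> H j = {}" using disjoint that by (simp add: disjoint_family_on_def)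
    ultimately have "S \<in> \<S>" "T \<in> \<S>" "S \<noteq> T" using H that by auto
    then show "far_apart sep S T" using far by (simp add: pairwise_def)
  qed
  ultimately show ?thesis by (intro exI[of _ "\<lambda>i. \<Union>(H i)"]) (auto simp: pairwise_def)
qed

context
  fixes S :: "nat set"
  assumes S: "S \<subseteq> support len" "S \<noteq> {}"
begin

lemma finite_cluster: "finite S"
  using S(1) finite_support by (rule finite_subset)

lemma cutoff_diff_le:
  "\<bar>cutoff sep S v - cutoff sep S u\<bar> * len v \<le> 4 / sep * L2_set (\<lambda>i. f i u + f i v) {..<k}"
proof -
  note range = cutoff_range[OF finite_cluster S(2) sep_pos]
  have zero: "f i a = 0" if "len a = 0" "i < k" for a i
    using that unfolding len_def by (subst (asm) L2_set_eq_0_iff) auto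
  consider (zero_v) "len v = 0" | (zero_u) "len u = 0" | (nonzero) "len u \<noteq> 0" "len v \<noteq> 0" by blast
  then show ?thesis
  proof cases
    case zero_v
    then show ?thesis using sep_pos by simp
  next
    case zero_u
    then have "L2_set (\<lambda>i. f i u + f i v) {..<k} = len v"
      unfolding len_def[of v] using zero by (intro L2_set_cong) auto
    moreover have "\<bar>cutoff sep S v - cutoff sep S u\<bar> * len v \<le> 4 / sep * len v"
    proof (rule mult_right_mono)
      have "1 \<le> 4 / sep" using sep_pos sep_le_1 by (intro mult_imp_le_div_pos) auto
      then show "\<bar>cutoff sep S v - cutoff sep S u\<bar> \<le> 4 / sep"
        using range[of u] range[of v] by linarith
    qed (rule len_nonneg)
    ultimately show ?thesis by simp
  next
    case nonzero
    have "\<bar>cutoff sep S v - cutoff sep S u\<bar> * len v \<le> 2 / sep * line_dist v u * len v"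
      using cutoff_lipschitz[OF finite_cluster S(2) sep_pos] len_nonneg by (rule mult_right_mono)
    also have "\<dots> = 2 / sep * (line_dist u v * len v)" by (simp add: dist_commute[of v u])
    also have "\<dots> \<le> 2 / sep * (2 * L2_set (\<lambda>i. f i u + f i v) {..<k})"
      using proj_dist_normalized_le[of "\<lambda>i. f i u" k "\<lambda>i. f i v"] nonzero sep_pos
      by (intro mult_left_mono) (auto simp: line_dist_def dir_def[abs_def] len_def)
    finally show ?thesis by simp
  qed
qed

lemma cutoff_edge_le:
  "L2_set (\<lambda>i. cutoff sep S u * f i u + cutoff sep S v * f i v) {..<k}
    \<le> 5 / sep * L2_set (\<lambda>i. f i u + f i v) {..<k}"
proof -
  let ?s = "L2_set (\<lambda>i. f i u + f i v) {..<k}" and ?c = "cutoff sep S"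
  note range = cutoff_range[OF finite_cluster S(2) sep_pos]
  have "(\<lambda>i. ?c u * f i u + ?c v * f i v) = (\<lambda>i. ?c u * (f i u + f i v) + (?c v - ?c u) * f i v)"
    by (auto simp: algebra_simps)
  then have "L2_set (\<lambda>i. ?c u * f i u + ?c v * f i v) {..<k}
      \<le> L2_set (\<lambda>i. ?c u * (f i u + f i v)) {..<k} + L2_set (\<lambda>i. (?c v - ?c u) * f i v) {..<k}"
    by (simp only: L2_set_triangle_ineq)
  also have "\<dots> = ?c u * ?s + \<bar>?c v - ?c u\<bar> * len v"
    unfolding L2_set_scale len_def using range(1) by simp
  also have "\<dots> \<le> 1 / sep * ?s + 4 / sep * ?s"
  proof (intro add_mono mult_right_mono cutoff_diff_le)
    have "1 \<le> 1 / sep" using sep_pos sep_le_1 by simp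
    then show "?c u \<le> 1 / sep" using range(2)[of u] by linarith
  qed simp
  finally show ?thesis by (simp add: distrib_right[symmetric] add_divide_distrib[symmetric])
qed

lemma sum_dual_energy_cutoff_le:
  "(\<Sum>j<k. dual_energy (\<lambda>u. cutoff sep S u * f j u)) \<le> 25 / sep\<^sup>2 * (\<Sum>j<k. dual_energy (f j))"
proof -
  have "(\<Sum>j<k. dual_energy (\<lambda>u. cutoff sep S u * f j u))
      \<le> (\<Sum>u<N. \<Sum>v<N. w u v * (5 / sep * L2_set (\<lambda>j. f j u + f j v) {..<k})\<^sup>2)"
    unfolding sum_dual_energy L2_set_power2[symmetric]
    using cutoff_edge_le by (intro sum_mono mult_left_mono power_mono) (auto simp: weight_nonneg)
  also have "\<dots> = (5 / sep)\<^sup>2 * (\<Sum>j<k. dual_energy (f j))"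
    unfolding sum_dual_energy L2_set_power2[symmetric] power_mult_distrib sum_distrib_left
    by (simp only: mult.left_commute)
  finally show ?thesis by (simp add: power_divide)
qed

lemma sum_mass_le_sum_sqnorm_cutoff: "sum mass S \<le> (\<Sum>j<k. sqnorm (\<lambda>u. cutoff sep S u * f j u))"
proof -
  have "sum mass S = (\<Sum>u\<in>S. deg N w u * (cutoff sep S u)\<^sup>2 * (len u)\<^sup>2)"
    by (intro sum.cong) (auto simp: mass_def cutoff_eq_1[OF finite_cluster S(2)])
  also have "\<dots> \<le> (\<Sum>u<N. deg N w u * (cutoff sep S u)\<^sup>2 * (len u)\<^sup>2)"
    using S(1) by (intro sum_mono2) (auto simp: support_def deg_nonneg)
  finally show ?thesis unfolding sum_mass_eq .
qed

lemma localized_function: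
  assumes mass: "1 / 2 \<le> sum mass S" and energy: "\<And>j. j < k \<Longrightarrow> dual_energy (f j) \<le> 2 * \<mu>" and "0 \<le> \<mu>"
  shows "\<exists>h. support h \<subseteq> support (cutoff sep S) \<and> rayleigh_le h (100 * real k / sep\<^sup>2 * \<mu>)"
proof -
  define h where "h j u = cutoff sep S u * f j u" for j u
  have norm: "1 / 2 \<le> (\<Sum>j<k. sqnorm (h j))"
    using mass sum_mass_le_sum_sqnorm_cutoff unfolding h_def by linarith
  have "(\<Sum>j<k. dual_energy (h j)) \<le> 25 / sep\<^sup>2 * (\<Sum>j<k. dual_energy (f j))"
    unfolding h_def by (rule sum_dual_energy_cutoff_le)
  also have "\<dots> \<le> 25 / sep\<^sup>2 * (real (card {..<k}) * (2 * \<mu>))"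
    using energy by (intro mult_left_mono sum_bounded_above) auto
  also have "\<dots> = 100 * real k / sep\<^sup>2 * \<mu> * (1 / 2)" by simp
  also have "\<dots> \<le> 100 * real k / sep\<^sup>2 * \<mu> * (\<Sum>j<k. sqnorm (h j))"
    using norm assms(3) by (intro mult_left_mono) auto
  finally have "\<exists>j\<in>{..<k}. 0 < sqnorm (h j) \<and>
      dual_energy (h j) \<le> 100 * real k / sep\<^sup>2 * \<mu> * sqnorm (h j)"
    using norm dual_energy_nonneg sqnorm_nonneg by (intro exists_index_with_ratio_le) auto
  then obtain j where "rayleigh_le (h j) (100 * real k / sep\<^sup>2 * \<mu>)" by (auto simp: rayleigh_le_def)
  moreover have "support (h j) \<subseteq> support (cutoff sep S)" by (auto simp: support_def h_def)
  ultimately show ?thesis by blast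
qed

end

lemma localized_functions:
  assumes "\<And>j. j < k \<Longrightarrow> dual_energy (f j) \<le> 2 * \<mu>" and "0 \<le> \<mu>"
  obtains g where "disjoint_family_on (\<lambda>i. support (g i)) {..<k}"
    "\<And>i. i < k \<Longrightarrow> rayleigh_le (g i) (100 * real k / sep\<^sup>2 * \<mu>)"
proof -
  obtain S where S: "\<forall>i<k. S i \<subseteq> support len \<and> 1 / 2 \<le> sum mass (S i)"
    "pairwise (\<lambda>i j. far_apart sep (S i) (S j)) {..<k}"
    using separated_clusters by blast
  have subset: "S i \<subseteq> support len" and nonempty: "S i \<noteq> {}" and mass: "1 / 2 \<le> sum mass (S i)"
    if "i < k" for i using S(1) that by auto
  obtain g where g: "\<And>i. i < k \<Longrightarrow> support (g i) \<subseteq> support (cutoff sep (S i))"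
    "\<And>i. i < k \<Longrightarrow> rayleigh_le (g i) (100 * real k / sep\<^sup>2 * \<mu>)"
    using localized_function[OF subset nonempty mass assms] by metis
  have "cutoff sep (S i) u = 0 \<or> cutoff sep (S j) u = 0" if "i < k" "j < k" "i \<noteq> j" for i j u
    using that S(2) subset nonempty finite_cluster sep_pos
    by (intro cutoffs_disjoint) (auto simp: pairwise_def)
  then have "support (g i) \<inter> support (g j) = {}" if "i < k" "j < k" "i \<noteq> j" for i j
    using g(1)[OF that(1)] g(1)[OF that(2)] that by (fastforce simp: support_def)
  then have "disjoint_family_on (\<lambda>i. support (g i)) {..<k}" by (simp add: disjoint_family_on_def)
  then show ?thesis using g(2) that by blast
qed

end

section \<open>Multi-way dual Cheeger constants\<close>

lemma hbar_ge:
  assumes "1 \<le> k" and admissible: "admissible_pairs N k A B"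
    and x: "\<And>i. i < k \<Longrightarrow> x \<le> phibar N w (A i) (B i)"
  shows "x \<le> hbar N w k"
proof -
  let ?M = "\<lambda>A B. Min {phibar N w (A i) (B i) | i. i < k}"
  let ?X = "{?M A B | A B. admissible_pairs N k A B}"
  have Min_attained: "\<exists>i<k. ?M A B = phibar N w (A i) (B i)" for A B
  proof -
    have "?M A B \<in> {phibar N w (A i) (B i) | i. i < k}"
      using assms(1) by (intro Min_in) (auto intro: exI[of _ 0])
    then show ?thesis by auto
  qed
  have "?X \<subseteq> (\<lambda>(P, Q). phibar N w P Q) ` (Pow {..<N} \<times> Pow {..<N})"
  proof
    fix y assume "y \<in> ?X"
    then obtain A B where AB: "y = ?M A B" "admissible_pairs N k A B" by blast
    obtain i where "i < k" "y = phibar N w (A i) (B i)" using Min_attained AB(1) by metis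
    then show "y \<in> (\<lambda>(P, Q). phibar N w P Q) ` (Pow {..<N} \<times> Pow {..<N})"
      using AB(2) unfolding admissible_pairs_def by (intro image_eqI[of _ _ "(A i, B i)"]) auto
  qed
  then have "finite ?X" by (rule finite_subset) simp
  moreover have "?M A B \<in> ?X" using admissible by blast
  ultimately have "?M A B \<le> hbar N w k" unfolding hbar_def by (rule Max_ge)
  moreover have "x \<le> ?M A B" using Min_attained[of A B] x by auto
  ultimately show ?thesis by linarith
qed

context weighted_graph
begin

lemma one_minus_hbar_le:
  assumes "1 \<le> k" and disjoint: "disjoint_family_on (\<lambda>i. support (g i)) {..<k}"
    and bipartite: "\<And>i. i < k \<Longrightarrow> almost_bipartite (support (g i)) \<epsilon>"
  shows "1 - hbar N w k \<le> \<epsilon>"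
proof -
  have "\<forall>i\<in>{..<k}. \<exists>A B. A \<union> B \<subseteq> support (g i) \<and> A \<inter> B = {} \<and> A \<union> B \<noteq> {} \<and>
      1 - phibar N w A B \<le> \<epsilon>"
    using bipartite by (simp add: almost_bipartite_def)
  then obtain A B where "\<forall>i\<in>{..<k}. A i \<union> B i \<subseteq> support (g i) \<and> A i \<inter> B i = {} \<and> A i \<union> B i \<noteq> {} \<and>
      1 - phibar N w (A i) (B i) \<le> \<epsilon>"
    unfolding bchoice_iff by (elim exE) blast
  then have AB: "A i \<union> B i \<subseteq> support (g i)" "A i \<inter> B i = {}" "A i \<union> B i \<noteq> {}"
    "1 - phibar N w (A i) (B i) \<le> \<epsilon>" if "i < k" for i using that by auto
  have separate: "(A i \<union> B i) \<inter> (A j \<union> B j) = {}" if "i < k" "j < k" "i \<noteq> j" for i j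
    using AB(1)[OF that(1)] AB(1)[OF that(2)] disjoint that
    unfolding disjoint_family_on_def by blast
  have "admissible_pairs N k A B"
    unfolding admissible_pairs_def
  proof (intro conjI allI impI)
    fix i assume i: "i < k"
    show "A i \<subseteq> {..<N}" "B i \<subseteq> {..<N}" using AB(1)[OF i] by (auto simp: support_def)
    show "A i \<union> B i \<noteq> {}" using AB(3)[OF i] .
    fix j assume j: "j < k"
    show "A i \<inter> B j = {}" using AB(2)[OF i] separate[OF i j] by (cases "i = j") auto
    assume "i \<noteq> j"
    then show "A i \<inter> A j = {}" "B i \<inter> B j = {}" using separate[OF i j] by auto
  qed
  moreover have "1 - \<epsilon> \<le> phibar N w (A i) (B i)" if "i < k" for i using AB(4)[OF that] by linarith
  ultimately have "1 - \<epsilon> \<le> hbar N w k" by (intro hbar_ge[OF assms(1)])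
  then show ?thesis by linarith
qed

lemma almost_bipartite_if_rayleigh_le:
  assumes kl_range: "1 \<le> k" "k \<le> l" "l \<le> N" and rayleigh: "rayleigh_le g (c * dual_gap k)"
  shows "almost_bipartite (support g) (16 * real l * (c * dual_gap k) / sqrt (dual_gap l))"
proof (cases "dual_gap l = 0")
  case True
  then have "dual_gap k = 0"
    using dual_gap_mono[OF kl_range] dual_gap_bounds(1)[of k] kl_range by simp
  then have "0 < sqnorm g" "dual_energy g = 0"
    using rayleigh dual_energy_nonneg[of g] by (auto simp: rayleigh_le_def)
  then show ?thesis using almost_bipartite_if_zero_energy[of g] True by simp
next
  case False
  then have gap: "0 < dual_gap l" using dual_gap_bounds(1)[of l] kl_range by simp
  have "almost_bipartite (support g) (16 * real l * (dual_energy g / sqnorm g) / sqrt (dual_gap l))"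
    using improved_dual_cheeger[OF _ kl_range(3) gap] kl_range rayleigh
    by (simp add: rayleigh_le_def)
  moreover have "dual_energy g / sqnorm g \<le> c * dual_gap k"
    using rayleigh by (simp add: rayleigh_le_def divide_le_eq)
  ultimately show ?thesis
    using gap by (elim almost_bipartite_mono) (intro divide_right_mono mult_left_mono, auto)
qed

end

theorem theorem6p4:
  shows "\<exists>C::real. C > 0 \<and>
    (\<forall>N w k l. wgraph N w \<longrightarrow> 1 \<le> k \<longrightarrow> k \<le> l \<longrightarrow> l \<le> N \<longrightarrow>
       1 - hbar N w k \<le> C * real l * real k ^ 6 *
         (2 - lambda N w (N - k + 1)) / sqrt (2 - lambda N w (N - l + 1)))"
proof (intro exI[of _ 163840000] conjI allI impI)
  fix N w k l assume "wgraph N w" and kl_range: "1 \<le> k" "k \<le> l" "l \<le> N"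
  then interpret weighted_graph N w by unfold_locales
  have "k \<le> N" using kl_range by simp
  then obtain f where f: "orthonormal k f" "\<And>i. i < k \<Longrightarrow> dual_energy (f i) = 2 * dual_gap (Suc i)"
    using dual_gap_eigenfunctions by blast
  then interpret spectral_embedding N w k f using kl_range(1) by unfold_locales
  have "dual_energy (f i) \<le> 2 * dual_gap k" if "i < k" for i
    using f(2)[OF that] dual_gap_mono[of "Suc i" k] that \<open>k \<le> N\<close> by simp
  then obtain g where g: "disjoint_family_on (\<lambda>i. support (g i)) {..<k}"
    "\<And>i. i < k \<Longrightarrow> rayleigh_le (g i) (100 * real k / sep\<^sup>2 * dual_gap k)"
    using localized_functions dual_gap_bounds(1)[OF kl_range(1) \<open>k \<le> N\<close>] by blast
  have "1 - hbar N w k \<le> 16 * real l * (100 * real k / sep\<^sup>2 * dual_gap k) / sqrt (dual_gap l)"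
    using kl_range(1) g(1) almost_bipartite_if_rayleigh_le[OF kl_range g(2)]
    by (rule one_minus_hbar_le)
  also have "100 * real k / sep\<^sup>2 = 10240000 * real k ^ 6"
    using inverse_sep_power2 by (simp add: divide_inverse flip: power_Suc)
  finally show "1 - hbar N w k \<le> 163840000 * real l * real k ^ 6 *
      (2 - lambda N w (N - k + 1)) / sqrt (2 - lambda N w (N - l + 1))"
    unfolding dual_gap_def by (simp add: mult_ac)
qed simp

end
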